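(* Let $n\ge 1$. (1) If $A\in M_n(\mathbb{T})$ is not strictly singular (i.e. $\det(A)\neq-\infty$), then $A^{\nabla}$ is factorizable over $\mathbb{T}$. (2) If $A\in M_n(R)$ is non-singular (i.e. $\det(A)$ is tangible), then $A^{\nabla\nabla}=(A^{\nabla})^{\nabla}$ is factorizable over $R$.
   Context: Let $\mathcal{G}$ be a totally ordered abelian group, e.g. $(\mathbb{R},+)$ or $(\mathbb{Q},+)$. The tropical semifield is $\mathbb{T}=\mathcal{G}\cup\{-\infty\}$ with addition $\max$ and multiplication the group operation; its zero is $0_{\mathbb{T}}=-\infty$ and its one $1_{\mathbb{T}}$ is the identity of $\mathcal{G}$. The supertropical semiring is $R=\mathcal{G}\cup\mathcal{G}^{\nu}\cup\{-\infty\}$, where $\mathcal{G}$ is the set of tangible elements and $\mathcal{G}^{\nu}=\{a^{\nu}:a\in\mathcal{G}\}$ is a disjoint ordered copy of $\mathcal{G}$ (the ghost elements). Put $(a^{\nu})^{\nu}=a^{\nu}$ and $(-\infty)^\nu=-\infty$; elements are compared through their $\nu$-values $a^\nu$. Addition: $a+b$ is the one of larger $\nu$-value if $a^{\nu}\ne b^{\nu}$, and $a+b=a^{\nu}$ if $a^{\nu}=b^{\nu}$. Multiplication is the group operation on the underlying elements of $\mathcal{G}$, the product being ghost if at least one factor is ghost; $-\infty$ is additively neutral and multiplicatively absorbing. $0_R=-\infty$, and $1_R$ is the (tangible) identity of $\mathcal{G}$. The invertible elements of $\mathbb{T}$ are those of $\mathcal G$, and the invertible elements of $R$ are the tangible ones.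 Let $S$ be $\mathbb{T}$ or $R$. For $A=(a_{i,j})\in M_n(S)$, $\det(A)=\sum_{\sigma\in S_n}a_{1,\sigma(1)}\cdots a_{n,\sigma(n)}$ (the permanent). The adjoint $\mathrm{adj}(A)$ has $(i,j)$ entry $\det(A_{j,i})$, where $A_{j,i}$ is $A$ with row $j$ and column $i$ deleted (the empty determinant is $1_S$). When $\det(A)$ is invertible, $A^{\nabla}=\det(A)^{-1}\mathrm{adj}(A)$. Elementary matrices over $S$: type 1, the identity matrix with two rows switched; type 2, the identity matrix with one diagonal entry replaced by some $k\in\mathcal{G}$; type 3, the identity matrix with one off-diagonal entry replaced by some $k\in\mathcal{G}$. A matrix is factorizable over $S$ if it is equal to a finite product of elementary matrices over $S$. *)

theory Defs
  imports "Jordan_Normal_Form.Determinant"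
begin

text \<open>
  The value group is written additively, as in the class
  \<^class>\<open>linordered_ab_group_add\<close>; hence the one of either semiring is the element
  of the group called \<open>0\<close>, and the zero of either semiring is minus infinity.
\<close>

datatype 'g trop = TNegInf | TFin 'g

instantiation trop :: (linordered_ab_group_add) comm_semiring_1
begin

definition zero_trop :: "'a trop" where "0 = TNegInf"
definition one_trop :: "'a trop" where "1 = TFin 0"

fun plus_trop :: "'a trop \<Rightarrow> 'a trop \<Rightarrow> 'a trop" where
  "TNegInf + y = y"
| "TFin a + TNegInf = TFin a"
| "TFin a + TFin b = TFin (max a b)"

fun times_trop :: "'a trop \<Rightarrow> 'a trop \<Rightarrow> 'a trop" where
  "TNegInf * y = TNegInf"
| "TFin a * TNegInf = TNegInf"
| "TFin a * TFin b = TFin (a + b)"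

instance
proof
  fix a b c :: "'a trop"
  show "a + b + c = a + (b + c)"
    by (cases a; cases b; cases c) (auto simp: max.assoc)
  show "a + b = b + a"
    by (cases a; cases b) (auto simp: max.commute)
  show "0 + a = a"
    by (simp add: zero_trop_def)
  show "a * b * c = a * (b * c)"
    by (cases a; cases b; cases c) (auto simp: add.assoc)
  show "a * b = b * a"
    by (cases a; cases b) (auto simp: add.commute)
  show "1 * a = a"
    by (cases a) (auto simp: one_trop_def)
  show "0 * a = 0"
    by (simp add: zero_trop_def)
  show "a * 0 = 0"
    by (cases a) (auto simp: zero_trop_def)
  show "(a + b) * c = a * c + b * c"
    by (cases a; cases b; cases c) (auto simp: max_add_distrib_left)
  show "(0 :: 'a trop) \<noteq> 1"
    by (simp add: zero_trop_def one_trop_def)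
qed

end

text \<open>Inverses of non-invertible elements are set to \<open>0\<close> by convention, here and below.\<close>

instantiation trop :: (linordered_ab_group_add) inverse
begin

fun inverse_trop :: "'a trop \<Rightarrow> 'a trop" where
  "inverse (TFin a) = TFin (- a)"
| "inverse TNegInf = 0"

definition divide_trop :: "'a trop \<Rightarrow> 'a trop \<Rightarrow> 'a trop" where
  "divide_trop x y = x * inverse y"

instance ..

end


datatype 'g supertrop = SNegInf | STan 'g | SGhost 'g

fun nu :: "'g supertrop \<Rightarrow> 'g supertrop" where
  "nu SNegInf = SNegInf"
| "nu (STan a) = SGhost a"
| "nu (SGhost a) = SGhost a"

text \<open>\<open>nu_less x y\<close> is the strict comparison of the ghosts \<open>nu x\<close> and \<open>nu y\<close>.\<close>

fun ghost_less :: "'g::ord supertrop \<Rightarrow> 'g supertrop \<Rightarrow> bool" where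
  "ghost_less SNegInf (SGhost b) = True"
| "ghost_less (SGhost a) (SGhost b) = (a < b)"
| "ghost_less _ _ = False"

definition nu_less :: "'g::ord supertrop \<Rightarrow> 'g supertrop \<Rightarrow> bool" where
  "nu_less x y \<longleftrightarrow> ghost_less (nu x) (nu y)"

instantiation supertrop :: (linordered_ab_group_add) comm_semiring_1
begin

definition zero_supertrop :: "'a supertrop" where "0 = SNegInf"
definition one_supertrop :: "'a supertrop" where "1 = STan 0"

definition plus_supertrop :: "'a supertrop \<Rightarrow> 'a supertrop \<Rightarrow> 'a supertrop" where
  "x + y = (if nu_less x y then y else if nu_less y x then x else nu x)"

fun times_supertrop :: "'a supertrop \<Rightarrow> 'a supertrop \<Rightarrow> 'a supertrop" where
  "SNegInf * y = SNegInf"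
| "x * SNegInf = SNegInf"
| "STan a * STan b = STan (a + b)"
| "STan a * SGhost b = SGhost (a + b)"
| "SGhost a * STan b = SGhost (a + b)"
| "SGhost a * SGhost b = SGhost (a + b)"

instance
proof
  fix a b c :: "'a supertrop"
  show "a + b + c = a + (b + c)"
    by (cases a; cases b; cases c) (auto simp: plus_supertrop_def nu_less_def)
  show "a + b = b + a"
    by (cases a; cases b) (auto simp: plus_supertrop_def nu_less_def)
  show "0 + a = a"
    by (cases a) (auto simp: zero_supertrop_def plus_supertrop_def nu_less_def)
  show "a * b * c = a * (b * c)"
    by (cases a; cases b; cases c) (auto simp: add.assoc)
  show "a * b = b * a"
    by (cases a; cases b) (auto simp: add.commute)
  show "1 * a = a"
    by (cases a) (auto simp: one_supertrop_def)
  show "0 * a = 0"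
    by (simp add: zero_supertrop_def)
  show "a * 0 = 0"
    by (cases a) (auto simp: zero_supertrop_def)
  show "(a + b) * c = a * c + b * c"
    by (cases a; cases b; cases c) (auto simp: plus_supertrop_def nu_less_def)
  show "(0 :: 'a supertrop) \<noteq> 1"
    by (simp add: zero_supertrop_def one_supertrop_def)
qed

end

instantiation supertrop :: (linordered_ab_group_add) inverse
begin

fun inverse_supertrop :: "'a supertrop \<Rightarrow> 'a supertrop" where
  "inverse (STan a) = STan (- a)"
| "inverse (SGhost a) = 0"
| "inverse SNegInf = 0"

definition divide_supertrop :: "'a supertrop \<Rightarrow> 'a supertrop \<Rightarrow> 'a supertrop" where
  "divide_supertrop x y = x * inverse y"

instance ..

end

lemma trop_invertible_iff:
  "x dvd 1 \<longleftrightarrow> x \<in> range TFin" for x :: "'g::linordered_ab_group_add trop"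
proof
  assume "x dvd 1"
  then obtain y where "1 = x * y" by (auto elim: dvdE)
  then show "x \<in> range TFin" by (cases x) (auto simp: one_trop_def)
next
  assume "x \<in> range TFin"
  then have "1 = x * inverse x" by (auto simp: one_trop_def)
  then show "x dvd 1" by (rule dvdI)
qed

lemma supertrop_invertible_iff:
  "x dvd 1 \<longleftrightarrow> x \<in> range STan" for x :: "'g::linordered_ab_group_add supertrop"
proof
  assume "x dvd 1"
  then obtain y where "1 = x * y" by (auto elim: dvdE)
  then show "x \<in> range STan" by (cases x; cases y) (auto simp: one_supertrop_def)
next
  assume "x \<in> range STan"
  then have "1 = x * inverse x" by (auto simp: one_supertrop_def)
  then show "x dvd 1" by (rule dvdI)
qed


text \<open>
  The determinant over these semirings is the permanent; the constant \<^const>\<open>det\<close>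
  needs signs, hence a ring. Matrix rows and columns are indexed from \<open>0\<close>.
\<close>

definition permanent :: "'a::comm_semiring_1 mat \<Rightarrow> 'a" where
  "permanent A = (\<Sum>p | p permutes {0..<dim_row A}. \<Prod>i = 0..<dim_row A. A $$ (i, p i))"

definition adjoint :: "'a::comm_semiring_1 mat \<Rightarrow> 'a mat" where
  "adjoint A = mat (dim_row A) (dim_col A) (\<lambda>(i, j). permanent (mat_delete A j i))"

definition nabla :: "'a::{comm_semiring_1, inverse} mat \<Rightarrow> 'a mat" where
  "nabla A = inverse (permanent A) \<cdot>\<^sub>m adjoint A"

text \<open>
  The parameter \<open>U\<close> is the copy of the value group inside the semiring, from which the
  scalars of elementary matrices are taken. In the third rule, \<^term>\<open>addrow_mat n k i j\<close> adds
  \<open>k\<close> to the entry \<open>0\<close> in the off-diagonal position \<open>(i, j)\<close>, so that entry becomes \<open>k\<close>.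
\<close>

inductive elementary_mat :: "'a::comm_semiring_1 set \<Rightarrow> nat \<Rightarrow> 'a mat \<Rightarrow> bool"
  for U :: "'a set" and n :: nat where
  switch: "i < n \<Longrightarrow> j < n \<Longrightarrow> i \<noteq> j \<Longrightarrow> elementary_mat U n (swaprows_mat n i j)"
| scale: "i < n \<Longrightarrow> k \<in> U \<Longrightarrow> elementary_mat U n (multrow_mat n i k)"
| add: "i < n \<Longrightarrow> j < n \<Longrightarrow> i \<noteq> j \<Longrightarrow> k \<in> U \<Longrightarrow> elementary_mat U n (addrow_mat n k i j)"

definition factorizable :: "'a::comm_semiring_1 set \<Rightarrow> nat \<Rightarrow> 'a mat \<Rightarrow> bool" where
  "factorizable U n A \<longleftrightarrow>
     (\<exists>Es. (\<forall>E \<in> set Es. elementary_mat U n E) \<and> A = foldr (*) Es (1\<^sub>m n))"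

end

theory Submission
  imports Defs
begin

text \<open>
  Both semirings satisfy \<open>x + x + x = x + x\<close>, and the argument is uniform in this setting.
  Dividing the rows of \<open>A\<close> by the entries of a permutation of maximal weight gives \<open>A = M B\<close>,
  with \<open>M\<close> monomial and \<open>B\<close> of unit diagonal whose other permutations, and hence all nontrivial
  closed walks, have weight absorbed by \<open>1\<close>. The adjoint commutes with monomial factors up to order,
  so only \<open>B\<close> matters, and there \<open>adj B\<close> sums the weights of paths (it is the Kleene star).

  A matrix \<open>C\<close> of unit diagonal in which \<open>C i j * C j k\<close> is absorbed by \<open>C i k\<close>
  for \<open>i \<noteq> j \<noteq> k\<close> is the product, in any order, of the matrices \<open>1 + C i j e\<^sub>i\<^sub>j\<close>; a ghost entry
  \<open>x\<^sup>\<nu> = x + x\<close> takes two elementary factors. Over \<open>\<T>\<close> this applies to \<open>adj B\<close>.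
  Over \<open>R\<close> it may fail for \<open>adj B\<close>, since \<open>C i k\<close> can be tangible of the same value as
  \<open>C i j * C j k\<close>, but in \<open>adj (adj B)\<close> such an entry has become ghost.
\<close>

section \<open>A common class for the two semirings\<close>

text \<open>\<open>unit_add_cases\<close> stands in for the total order and
  \<open>unit_or_ghost\<close> for the split into tangible and ghost elements: \<open>y + y\<close>
  is a ghost over \<open>supertrop\<close>, whereas over \<open>trop\<close> it is \<open>y\<close>
  itself.\<close>

class supertropical_semiring = comm_semiring_1 + inverse +
  assumes add_triple: "x + x + x = x + x"
    and unit_inverse: "x dvd 1 \<Longrightarrow> x * inverse x = 1"
    and unit_add_cases: "x + y dvd 1 \<Longrightarrow> x + y = x \<or> x + y = y"
    and unit_or_ghost: "x = 0 \<or> x dvd 1 \<or> (\<exists>y. y dvd 1 \<and> x = y + y)"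

instance trop :: (linordered_ab_group_add) supertropical_semiring
proof
  fix x y :: "'a trop"
  show "x + x + x = x + x"
    by (cases x) auto
  show "x dvd 1 \<Longrightarrow> x * inverse x = 1"
    unfolding trop_invertible_iff by (auto simp: one_trop_def)
  show "x + y dvd 1 \<Longrightarrow> x + y = x \<or> x + y = y"
    by (cases x; cases y) (auto simp: max_def)
  show "x = 0 \<or> x dvd 1 \<or> (\<exists>y. y dvd 1 \<and> x = y + y)"
    by (cases x) (auto simp: trop_invertible_iff zero_trop_def)
qed

instance supertrop :: (linordered_ab_group_add) supertropical_semiring
proof
  fix x y :: "'a supertrop"
  show "x + x + x = x + x"
    by (cases x) (auto simp: plus_supertrop_def nu_less_def)
  show "x dvd 1 \<Longrightarrow> x * inverse x = 1"
    unfolding supertrop_invertible_iff by (auto simp: one_supertrop_def)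
  show "x + y dvd 1 \<Longrightarrow> x + y = x \<or> x + y = y"
    unfolding supertrop_invertible_iff
    by (cases x; cases y) (auto simp: plus_supertrop_def nu_less_def split: if_splits)
  have "SGhost a = STan a + STan a" for a :: 'a
    by (simp add: plus_supertrop_def nu_less_def)
  then show "x = 0 \<or> x dvd 1 \<or> (\<exists>y. y dvd 1 \<and> x = y + y)"
    unfolding supertrop_invertible_iff
    by (cases x) (auto simp: zero_supertrop_def)
qed


section \<open>Absorption\<close>

text \<open>
  Over \<^typ>\<open>'g trop\<close>, \<open>x \<sqsubset> y\<close> and \<open>x \<lesssim> y\<close> both mean \<open>x \<le> y\<close>. Over \<^typ>\<open>'g supertrop\<close>,
  \<open>x \<lesssim> y\<close> compares the \<open>\<nu>\<close>-values, and so does \<open>x \<sqsubset> y\<close>, but strictly when \<open>y\<close> is tangible.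
  Thus \<open>\<sqsubset>\<close> is not reflexive: \<open>1 \<sqsubset> 1\<close> fails.
\<close>

definition absorbed :: "'a::comm_semiring_1 \<Rightarrow> 'a \<Rightarrow> bool" (infix "\<sqsubset>" 50) where
  "x \<sqsubset> y \<longleftrightarrow> x + y = y"

text \<open>The reflexive closure is needed because over \<open>supertrop\<close> a tangible element
  does not absorb itself.\<close>

definition absorbed_eq :: "'a::comm_semiring_1 \<Rightarrow> 'a \<Rightarrow> bool" (infix "\<sqsubseteq>" 50) where
  "x \<sqsubseteq> y \<longleftrightarrow> x = y \<or> x \<sqsubset> y"

definition nu_le :: "'a::comm_semiring_1 \<Rightarrow> 'a \<Rightarrow> bool" (infix "\<lesssim>" 50) where
  "x \<lesssim> y \<longleftrightarrow> x \<sqsubset> y + y"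

lemma absorbed_add_right: "x \<sqsubset> y \<Longrightarrow> x \<sqsubset> y + z"
  unfolding absorbed_def by (metis add.assoc)

lemma absorbed_add_left: "x \<sqsubset> z \<Longrightarrow> y \<sqsubset> z \<Longrightarrow> x + y \<sqsubset> z"
  unfolding absorbed_def by (metis add.assoc)

lemma absorbed_zero [simp]: "0 \<sqsubset> z"
  by (simp add: absorbed_def)

lemma absorbed_sum: "(\<And>i. i \<in> I \<Longrightarrow> f i \<sqsubset> z) \<Longrightarrow> sum f I \<sqsubset> z"
  by (induction I rule: infinite_finite_induct) (auto intro: absorbed_add_left)

lemma absorbed_trans: "x \<sqsubset> y \<Longrightarrow> y \<sqsubset> z \<Longrightarrow> x \<sqsubset> z"
  unfolding absorbed_def by (metis add.assoc)

lemma absorbed_mult_right: "x \<sqsubset> y \<Longrightarrow> x * z \<sqsubset> y * z"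
  unfolding absorbed_def by (metis distrib_right)

lemma absorbed_mult_left: "x \<sqsubset> y \<Longrightarrow> z * x \<sqsubset> z * y"
  unfolding absorbed_def by (metis distrib_left)

text \<open>Expanding \<open>z\<close> twice as \<open>x + y + z\<close> makes \<open>x + z\<close>
  contain three copies of \<open>x\<close>; \<open>add_triple\<close> removes one, and the rest
  folds back to \<open>z\<close>. This isolates a single term of an absorbed sum.\<close>

lemma absorbed_addD:
  fixes x y z :: "'a::supertropical_semiring"
  assumes "x + y \<sqsubset> z"
  shows "x \<sqsubset> z"
proof -
  have z: "x + y + z = z"
    using assms by (simp add: absorbed_def)
  have "x + z = x + (x + y + (x + y + z))"
    using z by simp
  also have "\<dots> = (x + x + x) + y + y + z"
    by (simp add: ac_simps)
  also have "\<dots> = x + y + (x + y + z)"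
    unfolding add_triple by (simp add: ac_simps)
  also have "\<dots> = z"
    using z by simp
  finally show ?thesis
    by (simp add: absorbed_def)
qed

lemma absorbed_eq_refl [simp]: "x \<sqsubseteq> x"
  by (simp add: absorbed_eq_def)

lemma absorbed_eq_trans [trans]: "x \<sqsubseteq> y \<Longrightarrow> y \<sqsubseteq> z \<Longrightarrow> x \<sqsubseteq> z"
  unfolding absorbed_eq_def by (auto intro: absorbed_trans)

lemma absorbed_eq_absorbed_trans [trans]: "x \<sqsubseteq> y \<Longrightarrow> y \<sqsubset> z \<Longrightarrow> x \<sqsubset> z"
  unfolding absorbed_eq_def by (auto intro: absorbed_trans)

lemma absorbed_eq_mult: "x \<sqsubseteq> y \<Longrightarrow> x' \<sqsubseteq> y' \<Longrightarrow> x * x' \<sqsubseteq> y * y'"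
  unfolding absorbed_eq_def
  by (metis absorbed_mult_left absorbed_mult_right absorbed_trans)

lemma absorbed_eq_mult_one: "x \<sqsubseteq> 1 \<Longrightarrow> x * y \<sqsubseteq> y"
  using absorbed_eq_mult[of x 1 y y] by simp

lemma nu_le_refl [simp]: "x \<lesssim> x" for x :: "'a::supertropical_semiring"
  by (simp add: nu_le_def absorbed_def add_triple flip: add.assoc)

lemma absorbed_imp_nu_le: "x \<sqsubset> y \<Longrightarrow> x \<lesssim> y"
  unfolding nu_le_def by (rule absorbed_add_right)

lemma absorbed_eq_imp_nu_le: "x \<sqsubseteq> y \<Longrightarrow> x \<lesssim> y" for x :: "'a::supertropical_semiring"
  unfolding absorbed_eq_def by (auto intro: absorbed_imp_nu_le)

text \<open>If \<open>z\<close> absorbs \<open>y\<close>, it also absorbs \<open>y + y\<close>.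
  Hence bounds on \<nu>-values suffice as long as the chain ends in an absorption.\<close>

lemma nu_le_absorbed_trans [trans]: "x \<lesssim> y \<Longrightarrow> y \<sqsubset> z \<Longrightarrow> x \<sqsubset> z"
  unfolding nu_le_def by (auto intro: absorbed_trans absorbed_add_left)

lemma nu_le_trans [trans]: "x \<lesssim> y \<Longrightarrow> y \<lesssim> z \<Longrightarrow> x \<lesssim> z"
  using nu_le_absorbed_trans unfolding nu_le_def by blast

lemma nu_le_sum: "(\<And>i. i \<in> I \<Longrightarrow> f i \<lesssim> z) \<Longrightarrow> sum f I \<lesssim> z"
  unfolding nu_le_def by (rule absorbed_sum)

lemma nu_le_add_right: "x \<lesssim> y \<Longrightarrow> x \<lesssim> y + z"
  unfolding nu_le_def using absorbed_add_right[of x "y + y" "z + z"] by (simp add: ac_simps)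

lemma nu_le_mult_right: "x \<lesssim> y \<Longrightarrow> x * z \<lesssim> y * z"
  unfolding nu_le_def using absorbed_mult_right[of x "y + y" z] by (simp add: distrib_right)

lemma nu_le_mult: "x \<lesssim> y \<Longrightarrow> x' \<lesssim> y' \<Longrightarrow> x * x' \<lesssim> y * y'"
  by (metis nu_le_mult_right nu_le_trans mult.commute)

lemma nu_le_member_sum:
  fixes x :: "'a::supertropical_semiring"
  assumes "finite I" "i \<in> I" "x \<lesssim> f i"
  shows "x \<lesssim> sum f I"
  using assms nu_le_add_right by (metis sum.remove)


section \<open>Definite matrices and walks\<close>

definition full_weight :: "nat \<Rightarrow> (nat \<Rightarrow> nat \<Rightarrow> 'a::comm_semiring_1) \<Rightarrow> (nat \<Rightarrow> nat) \<Rightarrow> 'a" where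
  "full_weight n B p = (\<Prod>k\<in>{0..<n}. B k (p k))"

definition minor_weight :: "nat \<Rightarrow> (nat \<Rightarrow> nat \<Rightarrow> 'a::comm_semiring_1) \<Rightarrow> (nat \<Rightarrow> nat) \<Rightarrow> nat \<Rightarrow> 'a" where
  "minor_weight n B p j = (\<Prod>k\<in>{0..<n} - {j}. B k (p k))"

text \<open>The \<open>(i, j)\<close> entry of the adjoint, with the row deletion expressed by \<open>p j = i\<close>.\<close>

definition cof :: "nat \<Rightarrow> (nat \<Rightarrow> nat \<Rightarrow> 'a::comm_semiring_1) \<Rightarrow> nat \<Rightarrow> nat \<Rightarrow> 'a" where
  "cof n B i j = (\<Sum>p | p permutes {0..<n} \<and> p j = i. minor_weight n B p j)"

text \<open>Over \<open>trop\<close> the second condition makes the identity a permutation of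
  maximal weight; over \<open>supertrop\<close> the bound is strict in \<nu>-value, so that the
  permanent is the tangible \<open>1\<close>.\<close>

definition definite :: "nat \<Rightarrow> (nat \<Rightarrow> nat \<Rightarrow> 'a::comm_semiring_1) \<Rightarrow> bool" where
  "definite n B \<longleftrightarrow> (\<forall>i<n. B i i = 1) \<and>
     (\<forall>p. p permutes {0..<n} \<longrightarrow> p \<noteq> id \<longrightarrow> full_weight n B p \<sqsubset> 1)"

lemma definite_diag: "definite n B \<Longrightarrow> i < n \<Longrightarrow> B i i = 1"
  and definite_absorbed: "definite n B \<Longrightarrow> p permutes {0..<n} \<Longrightarrow> p \<noteq> id \<Longrightarrow> full_weight n B p \<sqsubset> 1"
  by (auto simp: definite_def)

lemma full_weight_id: "definite n B \<Longrightarrow> full_weight n B id = 1"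
  by (auto simp: full_weight_def definite_diag intro: prod.neutral)

lemma definite_absorbed_eq: "definite n B \<Longrightarrow> p permutes {0..<n} \<Longrightarrow> full_weight n B p \<sqsubseteq> 1"
  by (metis absorbed_eq_def definite_absorbed full_weight_id)

lemma full_weight_split: "j < n \<Longrightarrow> full_weight n B p = B j (p j) * minor_weight n B p j"
  unfolding full_weight_def minor_weight_def by (simp add: prod.remove)

lemma minor_weight_eq_full_weight:
  "j < n \<Longrightarrow> p j = j \<Longrightarrow> B j j = 1 \<Longrightarrow> minor_weight n B p j = full_weight n B p"
  by (simp add: full_weight_split)

text \<open>\<open>transpose i (p i) \<circ> p\<close> takes \<open>i\<close> out of its cycle: \<open>j \<mapsto> i \<mapsto> p i\<close> becomes \<open>j \<mapsto> p i\<close>.\<close>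

lemma bypass_permutes:
  assumes "p permutes S" "i \<in> S"
  shows "transpose i (p i) \<circ> p permutes S"
  using assms by (auto intro!: permutes_compose permutes_swap_id simp: permutes_in_image)

lemma bypass_apply:
  assumes "p permutes S"
  shows "(transpose i (p i) \<circ> p) i = i"
    and "p j = i \<Longrightarrow> (transpose i (p i) \<circ> p) j = p i"
    and "k \<noteq> i \<Longrightarrow> p k \<noteq> i \<Longrightarrow> (transpose i (p i) \<circ> p) k = p k"
  using permutes_inj[OF assms] by (auto simp: transpose_def inj_eq)

text \<open>The measure for inductions on permutations: bypassing fixes \<open>i\<close>, and any
  other index moved afterwards was already moved before.\<close>

lemma bypass_moved:
  assumes "p permutes S" "finite S" "i \<in> S" "p i \<noteq> i"
  shows "card {k. (transpose i (p i) \<circ> p) k \<noteq> k} < card {k. p k \<noteq> k}"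
proof (rule psubset_card_mono)
  show "finite {k. p k \<noteq> k}"
    by (rule finite_subset[OF _ assms(2)]) (use assms(1) in \<open>auto simp: permutes_def\<close>)
  have "k = i \<or> p k \<noteq> k" if "(transpose i (p i) \<circ> p) k \<noteq> k" for k
    using bypass_apply(3)[OF assms(1), of k i] that by fastforce
  moreover have "(transpose i (p i) \<circ> p) i = i"
    by simp
  ultimately show "{k. (transpose i (p i) \<circ> p) k \<noteq> k} \<subset> {k. p k \<noteq> k}"
    using assms(4) by fastforce
qed

text \<open>The bypass changes \<open>p\<close> only at \<open>i\<close> and \<open>j\<close>. Row
  \<open>j\<close> is omitted from the weight, and in row \<open>i\<close> the factor becomes the
  diagonal entry \<open>1\<close>.\<close>

lemma minor_weight_bypass:
  assumes p: "p permutes {0..<n}" and i: "i < n" "p j = i" "i \<noteq> j" "B i i = 1"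
  shows "minor_weight n B p j = B i (p i) * minor_weight n B (transpose i (p i) \<circ> p) j"
proof -
  let ?p' = "transpose i (p i) \<circ> p"
  have eq: "?p' k = p k" if "k \<noteq> i" "k \<noteq> j" for k
    using bypass_apply(3)[OF p, of k i] that i permutes_inj[OF p] by (metis injD)
  have "minor_weight n B p j = B i (p i) * (\<Prod>k\<in>{0..<n} - {j} - {i}. B k (p k))"
    unfolding minor_weight_def using i by (intro prod.remove) auto
  also have "(\<Prod>k\<in>{0..<n} - {j} - {i}. B k (p k)) = (\<Prod>k\<in>{0..<n} - {j} - {i}. B k (?p' k))"
    by (rule prod.cong) (auto simp: eq simp del: comp_apply)
  also have "\<dots> = B i (?p' i) * \<dots>"
    using i by simp
  also have "\<dots> = minor_weight n B ?p' j"
    unfolding minor_weight_def using i by (intro prod.remove[symmetric]) auto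
  finally show ?thesis .
qed


section \<open>Weights of walks\<close>

fun walk_weight :: "(nat \<Rightarrow> nat \<Rightarrow> 'a::comm_semiring_1) \<Rightarrow> nat list \<Rightarrow> 'a" where
  "walk_weight B (x # y # vs) = B x y * walk_weight B (y # vs)"
| "walk_weight B [x] = 1"
| "walk_weight B [] = 1"

lemma walk_weight_append:
  "walk_weight B (us @ y # vs) = walk_weight B (us @ [y]) * walk_weight B (y # vs)"
proof (induction us)
  case (Cons u us)
  then show ?case
    by (cases us) (auto simp: mult.assoc)
qed simp

text \<open>Splitting at both visits of \<open>y\<close> gives three factors; commutativity brings
  the middle one, a closed walk at \<open>y\<close>, to the front.\<close>

lemma walk_weight_cut:
  "walk_weight B (us @ y # vs @ y # ws) = walk_weight B (y # vs @ [y]) * walk_weight B (us @ y # ws)"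
proof -
  have "walk_weight B (us @ y # vs @ y # ws)
      = walk_weight B (us @ [y]) * (walk_weight B ((y # vs) @ [y]) * walk_weight B (y # ws))"
    unfolding walk_weight_append[of B us y "vs @ y # ws"]
    using walk_weight_append[of B "y # vs" y ws] by simp
  also have "\<dots> = walk_weight B (y # vs @ [y]) * walk_weight B (us @ y # ws)"
    unfolding walk_weight_append[of B us y ws] by (simp add: mult.left_commute)
  finally show ?thesis .
qed

text \<open>The permutation is the cycle along the walk. Omitting the row of the last vertex drops
  the closing edge, and the fixed points contribute diagonal entries \<open>1\<close>.\<close>

lemma distinct_walk_permutation:
  assumes "vs \<noteq> []" "distinct vs" "set vs \<subseteq> {0..<n}" and diag: "\<And>i. i < n \<Longrightarrow> B i i = 1"
  shows "\<exists>p. p permutes {0..<n} \<and> p (last vs) = hd vs \<and> (\<forall>k. k \<notin> set vs \<longrightarrow> p k = k) \<and>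
           minor_weight n B p (last vs) = walk_weight B vs"
  using assms(1-3)
proof (induction vs rule: induct_list012)
  case (2 x)
  have "minor_weight n B id x = 1"
    by (auto simp: minor_weight_def diag intro: prod.neutral)
  then show ?case
    by (intro exI[of _ id]) (simp add: permutes_id del: id_apply, simp)
next
  case (3 x y vs)
  let ?j = "last (y # vs)"
  obtain q where q: "q permutes {0..<n}" "q ?j = y" "\<And>k. k \<notin> set (y # vs) \<Longrightarrow> q k = k"
      "minor_weight n B q ?j = walk_weight B (y # vs)"
    using 3 by auto
  \<comment> \<open>This inserts \<open>x\<close> into the cycle of \<open>q\<close> between the
    last vertex and \<open>y\<close>; bypassing \<open>x\<close> recovers \<open>q\<close>.\<close>
  define p where "p = transpose x y \<circ> q"
  have xy: "x \<noteq> y" "x \<notin> set (y # vs)" "x < n" "y < n" "x \<noteq> ?j"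
    using 3 by (auto split: if_splits)
  have p: "p permutes {0..<n}" "p ?j = x" "p x = y"
    using q xy by (auto simp: p_def intro!: permutes_compose permutes_swap_id)
  have "transpose x (p x) \<circ> p = q"
    unfolding p(3) by (simp add: p_def flip: comp_assoc)
  then have "minor_weight n B p ?j = B x y * walk_weight B (y # vs)"
    using minor_weight_bypass[of p n x ?j B] p xy diag q by simp
  moreover have "p k = k" if "k \<notin> set (x # y # vs)" for k
    using that q(3)[of k] by (auto simp: p_def transpose_def)
  ultimately show ?case
    using p by (intro exI[of _ p]) auto
qed simp

text \<open>Cut at a repeated vertex; a closed walk without one is a cyclic permutation.\<close>

lemma closed_walk_absorbed:
  assumes "definite n B" "set (x # vs) \<subseteq> {0..<n}"
  shows "walk_weight B (x # vs @ [x]) \<sqsubseteq> 1 \<and>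
    ((\<exists>y\<in>set vs. y \<noteq> x) \<longrightarrow> walk_weight B (x # vs @ [x]) \<sqsubset> 1)"
  using assms(2)
proof (induction "length vs" arbitrary: x vs rule: less_induct)
  case less
  show ?case
  proof (cases "distinct (x # vs)")
    case True
    show ?thesis
    proof (cases "vs = []")
      case True
      then show ?thesis
        using less.prems definite_diag[OF assms(1), of x] by simp
    next
      case False
      then obtain us z where vs: "vs = us @ [z]"
        by (meson rev_exhaust)
      obtain p where p: "p permutes {0..<n}" "p z = x"
          "minor_weight n B p z = walk_weight B (x # vs)"
        using distinct_walk_permutation[of "x # vs" n B] True less.prems definite_diag[OF assms(1)]
        by (auto simp: vs)
      \<comment> \<open>The factor of row \<open>z\<close>, omitted from the minor weight, is the
        edge that closes the walk.\<close>
      have "full_weight n B p = B z x * walk_weight B (x # vs)"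
        using p less.prems by (simp add: full_weight_split[of z] vs)
      also have "\<dots> = walk_weight B (x # vs @ [x])"
        using walk_weight_append[of B "x # us" z "[x]"] by (simp add: vs mult.commute)
      finally have "full_weight n B p = walk_weight B (x # vs @ [x])" .
      moreover have "p \<noteq> id"
        using p(2) True by (auto simp: vs)
      ultimately have "walk_weight B (x # vs @ [x]) \<sqsubset> 1"
        using definite_absorbed[OF assms(1) p(1)] by simp
      then show ?thesis
        by (simp add: absorbed_eq_def)
    qed
  next
    case False
    then obtain as y bs cs where eq: "x # vs = as @ [y] @ bs @ [y] @ cs"
      using not_distinct_decomp by blast
    \<comment> \<open>The walk left after the cut still starts at \<open>x\<close>: if
      \<open>as\<close> is empty, then \<open>y = x\<close> and \<open>us\<close> is
      \<open>cs\<close>; otherwise \<open>us\<close> contains \<open>y\<close>.\<close>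
    obtain us where us: "as @ y # cs = x # us" "length us < length vs" "length bs < length vs"
        "set vs \<subseteq> set bs \<union> {x, y} \<union> set us" "y \<in> set us \<union> {x}" "set us \<union> set bs \<subseteq> set (x # vs)"
      using eq by (cases as) auto
    let ?a = "walk_weight B (y # bs @ [y])" and ?b = "walk_weight B (x # us @ [x])"
    have prod: "walk_weight B (x # vs @ [x]) = ?a * ?b"
      using walk_weight_cut[of B as y bs "cs @ [x]"] eq us(1)
      by (metis append.assoc append_Cons append_Nil)
    have sub: "set (y # bs) \<subseteq> {0..<n}" "set (x # us) \<subseteq> {0..<n}"
      using us(5,6) less.prems by auto
    note IH = less.hyps[OF us(3) sub(1)] less.hyps[OF us(2) sub(2)]
    have "?a * ?b \<sqsubseteq> 1"
      using absorbed_eq_mult[of ?a 1 ?b 1] IH by simp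
    moreover have "?a * ?b \<sqsubset> 1" if ex: "\<exists>z\<in>set vs. z \<noteq> x"
    proof -
      \<comment> \<open>A vertex other than \<open>x\<close> makes one of the two pieces nontrivial:
        the outer one if it contains such a vertex, and otherwise \<open>y = x\<close> and the
        vertex lies in \<open>bs\<close>. One absorbed factor suffices.\<close>
      obtain z where "z \<in> set bs \<or> z = y \<or> z \<in> set us" "z \<noteq> x"
        using us(4) ex by auto
      then have "(\<exists>z\<in>set us. z \<noteq> x) \<or> (\<exists>z\<in>set bs. z \<noteq> y)"
        using us(5) by auto
      then show ?thesis
      proof
        assume "\<exists>z\<in>set us. z \<noteq> x"
        then have "?b \<sqsubset> 1"
          using IH by blast
        then show ?thesis
          using absorbed_eq_mult_one[of ?a ?b] IH absorbed_eq_absorbed_trans by blast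
      next
        assume "\<exists>z\<in>set bs. z \<noteq> y"
        then have "?a \<sqsubset> 1"
          using IH by blast
        then show ?thesis
          using absorbed_eq_mult_one[of ?b ?a] IH absorbed_eq_absorbed_trans by (metis mult.commute)
      qed
    qed
    ultimately show ?thesis
      by (simp add: prod)
  qed
qed

text \<open>Deleting a closed subwalk removes a factor \<sqsubseteq> \<open>1\<close>. Repeated
  deletion ends in a walk with distinct vertices, which is part of a cycle.\<close>

lemma walk_absorbed_permutation:
  assumes "definite n B" "vs \<noteq> []" "set vs \<subseteq> {0..<n}"
  shows "\<exists>p. p permutes {0..<n} \<and> p (last vs) = hd vs \<and>
           walk_weight B vs \<sqsubseteq> minor_weight n B p (last vs)"
  using assms(2,3)
proof (induction "length vs" arbitrary: vs rule: less_induct)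
  case less
  show ?case
  proof (cases "distinct vs")
    case True
    then show ?thesis
      using distinct_walk_permutation[OF less.prems(1) True less.prems(2), of B] definite_diag[OF assms(1)]
      by fastforce
  next
    case False
    then obtain as y bs cs where eq: "vs = as @ [y] @ bs @ [y] @ cs"
      using not_distinct_decomp by blast
    let ?us = "as @ y # cs"
    obtain p where p: "p permutes {0..<n}" "p (last ?us) = hd ?us"
        "walk_weight B ?us \<sqsubseteq> minor_weight n B p (last ?us)"
      using less.hyps[of ?us] less.prems by (auto simp: eq)
    have "walk_weight B (y # bs @ [y]) \<sqsubseteq> 1"
      using closed_walk_absorbed[OF assms(1), of y bs] less.prems by (auto simp: eq)
    then have "walk_weight B vs \<sqsubseteq> 1 * walk_weight B ?us"
      unfolding eq using walk_weight_cut[of B as y bs cs]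
      by (auto intro!: absorbed_eq_mult simp del: mult_1_left)
    moreover have "last vs = last ?us" "hd vs = hd ?us"
      by (auto simp: eq hd_append)
    ultimately show ?thesis
      using p absorbed_eq_trans by (intro exI[of _ p]) auto
  qed
qed

text \<open>The walk follows the cycle of \<open>p\<close> from \<open>p j\<close> to
  \<open>j\<close>. Each bypass splits off its first edge; what remains at the end are the other
  cycles, of weight \<sqsubseteq> \<open>1\<close>.\<close>

lemma permutation_absorbed_walk:
  assumes "definite n B" "p permutes {0..<n}" "j < n"
  shows "\<exists>vs. vs \<noteq> [] \<and> set vs \<subseteq> {0..<n} \<and> hd vs = p j \<and> last vs = j \<and>
           minor_weight n B p j \<sqsubseteq> walk_weight B vs"
  using assms(2)
proof (induction "card {k. p k \<noteq> k}" arbitrary: p rule: less_induct)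
  case less
  show ?case
  proof (cases "p j = j")
    case True
    \<comment> \<open>Once \<open>j\<close> is fixed, the omitted factor is \<open>1\<close>, so
      definiteness bounds the minor weight by \<open>1\<close>, the weight of the trivial
      walk.\<close>
    then have "minor_weight n B p j \<sqsubseteq> walk_weight B [j]"
      using definite_absorbed_eq[OF assms(1) less.prems] definite_diag[OF assms(1,3)]
      by (simp add: minor_weight_eq_full_weight assms(3))
    then show ?thesis
      using True assms(3) by (intro exI[of _ "[j]"]) auto
  next
    case False
    let ?i = "p j"
    let ?p' = "transpose ?i (p ?i) \<circ> p"
    have i: "?i < n" "p ?i \<noteq> ?i"
      using less.prems assms(3) False permutes_in_image[OF less.prems, of j]
        permutes_inj[OF less.prems] by (auto simp: inj_eq)
    have p': "?p' permutes {0..<n}" "?p' j = p ?i"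
      using bypass_permutes[OF less.prems, of ?i] i bypass_apply(2)[OF less.prems, of j ?i] by auto
    obtain vs where vs: "vs \<noteq> []" "set vs \<subseteq> {0..<n}" "hd vs = p ?i" "last vs = j"
        "minor_weight n B ?p' j \<sqsubseteq> walk_weight B vs"
      using less.hyps[OF bypass_moved[OF less.prems _ _ i(2)] p'(1)] i p'(2) by auto
    have "minor_weight n B p j = B ?i (p ?i) * minor_weight n B ?p' j"
      using False i definite_diag[OF assms(1) i(1)] by (intro minor_weight_bypass[OF less.prems]) auto
    also have "\<dots> \<sqsubseteq> B ?i (p ?i) * walk_weight B vs"
      by (intro absorbed_eq_mult vs(5)) simp
    also have "\<dots> = walk_weight B (?i # vs)"
      using vs(1,3) by (cases vs) auto
    finally show ?thesis
      using vs i by (intro exI[of _ "?i # vs"]) auto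
  qed
qed

lemma walk_weight_join:
  assumes "vs \<noteq> []" "ws \<noteq> []" "last vs = hd ws"
  shows "walk_weight B (vs @ tl ws) = walk_weight B vs * walk_weight B ws"
proof -
  obtain us y where vs: "vs = us @ [y]"
    using assms(1) by (meson rev_exhaust)
  then have "ws = y # tl ws"
    using assms(2,3) by (cases ws) auto
  then show ?thesis
    using walk_weight_append[of B us y "tl ws"] vs by simp
qed

section \<open>The adjoint of a definite matrix\<close>

text \<open>Both factors turn into walks, which are joined at \<open>q k\<close>; the joined walk
  turns back into a permutation.\<close>

lemma minor_weight_mult_absorbed:
  assumes B: "definite n B" and p: "p permutes {0..<n}" and q: "q permutes {0..<n}" and k: "k < n"
  shows "\<exists>r. r permutes {0..<n} \<and> r k = p (q k) \<and>
           minor_weight n B p (q k) * minor_weight n B q k \<sqsubseteq> minor_weight n B r k"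
proof -
  have qk: "q k < n"
    using q k permutes_in_image by fastforce
  obtain vs where vs: "vs \<noteq> []" "set vs \<subseteq> {0..<n}" "hd vs = p (q k)" "last vs = q k"
      "minor_weight n B p (q k) \<sqsubseteq> walk_weight B vs"
    using permutation_absorbed_walk[OF B p qk] by blast
  obtain ws where ws: "ws \<noteq> []" "set ws \<subseteq> {0..<n}" "hd ws = q k" "last ws = k"
      "minor_weight n B q k \<sqsubseteq> walk_weight B ws"
    using permutation_absorbed_walk[OF B q k] by blast
  let ?us = "vs @ tl ws"
  have us: "?us \<noteq> []" "set ?us \<subseteq> {0..<n}" "hd ?us = p (q k)" "last ?us = k"
    using vs ws by (cases ws; auto simp: last_append)+
  obtain r where r: "r permutes {0..<n}" "r k = p (q k)"
      "walk_weight B ?us \<sqsubseteq> minor_weight n B r k"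
    using walk_absorbed_permutation[OF B us(1,2)] us by auto
  have "minor_weight n B p (q k) * minor_weight n B q k \<sqsubseteq> walk_weight B ?us"
    using vs ws by (simp add: walk_weight_join absorbed_eq_mult)
  then show ?thesis
    using r absorbed_eq_trans by blast
qed

text \<open>The two walks join to a closed walk at \<open>i\<close> that passes through
  \<open>j\<close>, hence a nontrivial one.\<close>

lemma minor_weight_cycle_absorbed:
  assumes B: "definite n B" and p: "p permutes {0..<n}" and q: "q permutes {0..<n}"
    and ij: "i < n" "j < n" "i \<noteq> j" "p j = i" "q i = j"
  shows "minor_weight n B p j * minor_weight n B q i \<sqsubset> 1"
proof -
  obtain vs where vs: "vs \<noteq> []" "set vs \<subseteq> {0..<n}" "hd vs = i" "last vs = j"
      "minor_weight n B p j \<sqsubseteq> walk_weight B vs"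
    using permutation_absorbed_walk[OF B p ij(2)] ij by blast
  obtain ws where ws: "ws \<noteq> []" "set ws \<subseteq> {0..<n}" "hd ws = j" "last ws = i"
      "minor_weight n B q i \<sqsubseteq> walk_weight B ws"
    using permutation_absorbed_walk[OF B q ij(1)] ij by blast
  obtain us where us: "vs = i # us" "us \<noteq> []" "last us = j"
    using vs ij by (cases vs) (auto split: if_splits)
  obtain zs where zs: "ws = j # zs @ [i]"
    using ws ij by (cases ws; cases "tl ws" rule: rev_cases) (auto split: if_splits)
  have "minor_weight n B p j * minor_weight n B q i \<sqsubseteq> walk_weight B (vs @ tl ws)"
    using vs ws by (simp add: walk_weight_join absorbed_eq_mult)
  also have "vs @ tl ws = i # (us @ zs) @ [i]"
    using us zs by simp
  also have "walk_weight B \<dots> \<sqsubset> 1"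
  proof -
    have "\<exists>y\<in>set (us @ zs). y \<noteq> i"
      using us ij(3) by (intro bexI[of _ j]) auto
    moreover have "set (i # us @ zs) \<subseteq> {0..<n}"
      using vs(2) ws(2) us(1) zs by auto
    ultimately show "walk_weight B (i # (us @ zs) @ [i]) \<sqsubset> 1"
      using closed_walk_absorbed[OF B, of i "us @ zs"] by metis
  qed
  finally show ?thesis .
qed

lemma finite_permutations_fixing [simp]: "finite {p. p permutes {0..<n} \<and> p j = i}" for n :: nat
  by (rule finite_subset[OF _ finite_permutations[of "{0..<n}"]]) auto

lemma cof_mult:
  "cof n B i j * cof n B j k =
     (\<Sum>p | p permutes {0..<n} \<and> p j = i. \<Sum>q | q permutes {0..<n} \<and> q k = j.
        minor_weight n B p j * minor_weight n B q k)"
  by (simp add: cof_def sum_product)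

text \<open>Each product of terms is bounded by a single term of the entry \<open>(i, k)\<close>.
  Only \<nu>-values are compared here, because the entry may be tangible while the product has the
  same value.\<close>

lemma cof_triangle:
  fixes B :: "nat \<Rightarrow> nat \<Rightarrow> 'a::supertropical_semiring"
  assumes "definite n B" "k < n"
  shows "cof n B i j * cof n B j k \<lesssim> cof n B i k"
  unfolding cof_mult
proof (intro nu_le_sum)
  fix p q
  assume p: "p \<in> {p. p permutes {0..<n} \<and> p j = i}" and q: "q \<in> {q. q permutes {0..<n} \<and> q k = j}"
  obtain r where r: "r permutes {0..<n}" "r k = i"
      "minor_weight n B p j * minor_weight n B q k \<sqsubseteq> minor_weight n B r k"
    using minor_weight_mult_absorbed[OF assms(1), of p q k] p q assms(2) by auto
  then show "minor_weight n B p j * minor_weight n B q k \<lesssim> cof n B i k"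
    unfolding cof_def by (intro nu_le_member_sum[of _ r]) (auto intro: absorbed_eq_imp_nu_le)
qed

lemma add_double_sum:
  assumes "\<And>i. i \<in> I \<Longrightarrow> f i + f i + z = f i + z"
  shows "sum f I + sum f I + z = sum f I + (z :: 'a::comm_monoid_add)"
  using assms
proof (induction I rule: infinite_finite_induct)
  case (insert i I)
  have "sum f (insert i I) + sum f (insert i I) + z = f i + f i + (sum f I + sum f I + z)"
    using insert.hyps by (simp add: ac_simps)
  also have "\<dots> = f i + f i + (sum f I + z)"
    using insert by simp
  also have "\<dots> = sum f I + (f i + f i + z)"
    by (simp add: ac_simps)
  also have "\<dots> = sum f I + (f i + z)"
    using insert.prems by simp
  also have "\<dots> = sum f (insert i I) + z"
    using insert.hyps by (simp add: ac_simps)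
  finally show ?case .
qed auto

text \<open>If \<open>y\<close> absorbs \<open>x\<close>, all copies of \<open>x\<close> vanish; if
  \<open>x = y\<close>, then \<open>y\<close> itself is the third copy required by
  \<open>add_triple\<close>.\<close>

lemma add_double_absorbed_eq:
  fixes x y z :: "'a::supertropical_semiring"
  assumes "x \<sqsubseteq> y"
  shows "x + x + (y + z) = x + (y + z)"
proof (cases "x \<sqsubset> y")
  case True
  then show ?thesis
    unfolding absorbed_def by (metis add.assoc)
next
  case False
  then have "x = y"
    using assms by (simp add: absorbed_eq_def)
  then show ?thesis
    by (metis add.assoc add_triple)
qed

text \<open>
  A product of terms that reaches the value of \<open>cof n B i k\<close> is itself a term of \<open>cof n B i k\<close>,
  so a second copy of it changes nothing, by \<open>x + x + x = x + x\<close>.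
\<close>

lemma cof_mult_add_double:
  fixes B :: "nat \<Rightarrow> nat \<Rightarrow> 'a::supertropical_semiring"
  assumes "definite n B" "k < n"
  shows "cof n B i j * cof n B j k + cof n B i j * cof n B j k + cof n B i k
       = cof n B i j * cof n B j k + cof n B i k"
  unfolding cof_mult
proof (intro add_double_sum)
  fix p q
  assume p: "p \<in> {p. p permutes {0..<n} \<and> p j = i}" and q: "q \<in> {q. q permutes {0..<n} \<and> q k = j}"
  let ?w = "minor_weight n B p j * minor_weight n B q k"
  obtain r where r: "r permutes {0..<n}" "r k = i" "?w \<sqsubseteq> minor_weight n B r k"
    using minor_weight_mult_absorbed[OF assms(1), of p q k] p q assms(2) by auto
  then show "?w + ?w + cof n B i k = ?w + cof n B i k"
    unfolding cof_def
    by (subst (1 2) sum.remove[of _ r]) (auto intro: add_double_absorbed_eq)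
qed

lemma sum_absorbed_eq_member:
  assumes "finite I" "a \<in> I" "\<And>i. i \<in> I \<Longrightarrow> i \<noteq> a \<Longrightarrow> f i \<sqsubset> f a"
  shows "sum f I = f a"
proof -
  have "sum f (I - {a}) \<sqsubset> f a"
    using assms by (intro absorbed_sum) auto
  then show ?thesis
    using assms by (simp add: sum.remove absorbed_def add.commute)
qed

text \<open>For permutations fixing \<open>i\<close> the omitted factor is \<open>1\<close>, so
  their minor weights are full weights, and the identity absorbs the others.\<close>

lemma cof_diag:
  assumes "definite n B" "i < n"
  shows "cof n B i i = 1"
proof -
  have eq: "minor_weight n B p i = full_weight n B p" if "p i = i" for p
    using that assms by (intro minor_weight_eq_full_weight definite_diag)
  have "cof n B i i = minor_weight n B id i"
    unfolding cof_def using assms full_weight_id[OF assms(1)]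
    by (intro sum_absorbed_eq_member) (auto simp: eq permutes_id definite_absorbed)
  then show ?thesis
    using eq[of id] full_weight_id[OF assms(1)] by simp
qed

lemma cof_cycle_absorbed:
  assumes "definite n B" "i < n" "j < n" "i \<noteq> j"
  shows "cof n B i j * cof n B j i \<sqsubset> 1"
  unfolding cof_mult
  by (intro absorbed_sum) (use assms in \<open>auto intro: minor_weight_cycle_absorbed\<close>)

text \<open>Bypassing the vertices of a cycle one by one does not lower its \<nu>-value, by
  \<open>triangle\<close>, until a 2-cycle is left, which \<open>cycle\<close> handles.\<close>

lemma definite_of_triangle:
  fixes X :: "nat \<Rightarrow> nat \<Rightarrow> 'a::supertropical_semiring"
  assumes diag: "\<And>i. i < n \<Longrightarrow> X i i = 1"
    and triangle: "\<And>i j k. i < n \<Longrightarrow> j < n \<Longrightarrow> k < n \<Longrightarrow> X i j * X j k \<lesssim> X i k"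
    and cycle: "\<And>i j. i < n \<Longrightarrow> j < n \<Longrightarrow> i \<noteq> j \<Longrightarrow> X i j * X j i \<sqsubset> 1"
  shows "definite n X"
proof -
  have "full_weight n X p \<sqsubset> 1" if "p permutes {0..<n}" "p \<noteq> id" for p
    using that
  proof (induction "card {k. p k \<noteq> k}" arbitrary: p rule: less_induct)
    case less
    note p = less.prems(1)
    obtain j where j: "p j \<noteq> j"
      using less.prems(2) by (auto simp: fun_eq_iff)
    then have "j < n"
      using p by (metis atLeastLessThan_iff permutes_not_in zero_le)
    let ?i = "p j"
    have i: "?i < n" "p ?i < n" "p ?i \<noteq> ?i"
      using p \<open>j < n\<close> j permutes_in_image[OF p] permutes_inj[OF p] by (auto simp: inj_eq)
    define p' where "p' = transpose ?i (p ?i) \<circ> p"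
    have p': "p' permutes {0..<n}" "p' j = p ?i"
      using bypass_permutes[OF p, of ?i] i bypass_apply(2)[OF p, of j ?i] by (auto simp: p'_def)
    have IH: "p' \<noteq> id \<Longrightarrow> full_weight n X p' \<sqsubset> 1"
      using less.hyps bypass_moved[OF p _ _ i(3)] i p'(1) by (simp add: p'_def)
    have eq: "full_weight n X p = (X j ?i * X ?i (p ?i)) * minor_weight n X p' j"
      using minor_weight_bypass[OF p i(1) refl j, of X] diag[OF i(1)]
      by (simp add: full_weight_split[OF \<open>j < n\<close>] p'_def mult.assoc)
    show ?case
    proof (cases "p ?i = j")
      case True
      \<comment> \<open>Here \<open>j\<close> and \<open>p j\<close> form a 2-cycle, and
        \<open>p'\<close> fixes both. It may be the identity, so its weight is only \<sqsubseteq>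
        \<open>1\<close>; the absorption comes from the 2-cycle.\<close>
      have "minor_weight n X p' j = full_weight n X p'"
        using True p' \<open>j < n\<close> diag by (intro minor_weight_eq_full_weight) auto
      moreover have "full_weight n X p' \<sqsubseteq> 1"
        using IH diag by (cases "p' = id") (auto simp: absorbed_eq_def full_weight_def)
      ultimately have "full_weight n X p \<sqsubseteq> (X j ?i * X ?i j) * 1"
        unfolding eq True by (intro absorbed_eq_mult) auto
      also have "\<dots> \<sqsubset> 1"
        using cycle[OF \<open>j < n\<close> i(1)] j by simp
      finally show ?thesis .
    next
      case False
      have "full_weight n X p \<lesssim> X j (p ?i) * minor_weight n X p' j"
        unfolding eq using \<open>j < n\<close> i by (intro nu_le_mult_right triangle)
      also have "\<dots> = full_weight n X p'"
        using p' by (simp add: full_weight_split[OF \<open>j < n\<close>])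
      also have "\<dots> \<sqsubset> 1"
        using IH p' False by (metis id_apply)
      finally show ?thesis .
    qed
  qed
  then show ?thesis
    using diag by (auto simp: definite_def)
qed

lemma definite_cof:
  fixes B :: "nat \<Rightarrow> nat \<Rightarrow> 'a::supertropical_semiring"
  assumes "definite n B"
  shows "definite n (cof n B)"
  using assms by (intro definite_of_triangle) (auto intro: cof_diag cof_triangle cof_cycle_absorbed)

section \<open>The second adjoint\<close>

lemma walk_weight_triangle:
  fixes X :: "nat \<Rightarrow> nat \<Rightarrow> 'a::supertropical_semiring"
  assumes diag: "\<And>i. i < n \<Longrightarrow> X i i = 1"
    and triangle: "\<And>i j k. i < n \<Longrightarrow> j < n \<Longrightarrow> k < n \<Longrightarrow> X i j * X j k \<lesssim> X i k"
    and "vs \<noteq> []" "set vs \<subseteq> {0..<n}"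
  shows "walk_weight X vs \<lesssim> X (hd vs) (last vs)"
  using assms(3,4)
proof (induction vs rule: induct_list012)
  case (3 x y vs)
  have "walk_weight X (x # y # vs) \<lesssim> X x y * X y (last (y # vs))"
    using nu_le_mult[OF nu_le_refl, of "walk_weight X (y # vs)" "X y (last (y # vs))" "X x y"] 3
    by auto
  also have "\<dots> \<lesssim> X x (last (y # vs))"
    using 3 by (intro triangle) (auto dest: subsetD[OF _ last_in_set])
  finally show ?case
    by simp
qed (auto simp: diag)

text \<open>A term is bounded by the weight of a walk from \<open>i\<close> to \<open>j\<close>,
  which \<open>triangle\<close> collapses to a single edge. So a second adjoint does not raise
  \<nu>-values.\<close>

lemma cof_nu_le:
  fixes X :: "nat \<Rightarrow> nat \<Rightarrow> 'a::supertropical_semiring"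
  assumes X: "definite n X"
    and triangle: "\<And>i j k. i < n \<Longrightarrow> j < n \<Longrightarrow> k < n \<Longrightarrow> X i j * X j k \<lesssim> X i k"
    and "j < n"
  shows "cof n X i j \<lesssim> X i j"
  unfolding cof_def
proof (intro nu_le_sum)
  fix p assume p: "p \<in> {p. p permutes {0..<n} \<and> p j = i}"
  obtain vs where "vs \<noteq> []" "set vs \<subseteq> {0..<n}" "hd vs = i" "last vs = j"
      "minor_weight n X p j \<sqsubseteq> walk_weight X vs"
    using permutation_absorbed_walk[OF X, of p j] p assms(3) by auto
  then show "minor_weight n X p j \<lesssim> X i j"
    using walk_weight_triangle[of n X vs] definite_diag[OF X] triangle
    by (metis absorbed_eq_imp_nu_le nu_le_trans)
qed

lemma minor_weight_id: "(\<And>i. i < n \<Longrightarrow> X i i = 1) \<Longrightarrow> minor_weight n X id j = 1"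
  by (auto simp: minor_weight_def intro: prod.neutral)

lemma minor_weight_transpose:
  assumes diag: "\<And>i. i < n \<Longrightarrow> X i i = 1" and "i < n" "j < n" "i \<noteq> j"
  shows "minor_weight n X (transpose i j) j = X i j"
  using minor_weight_bypass[of "transpose i j" n i j X] assms
  by (simp add: permutes_swap_id minor_weight_id)

text \<open>The cycle runs from \<open>i\<close> to \<open>j\<close> to \<open>k\<close> and back to
  \<open>i\<close>; omitting row \<open>k\<close> drops the closing edge.\<close>

lemma minor_weight_three_cycle:
  assumes diag: "\<And>i. i < n \<Longrightarrow> X i i = 1"
    and "i < n" "j < n" "k < n" "i \<noteq> j" "j \<noteq> k" "i \<noteq> k"
  shows "minor_weight n X (transpose i j \<circ> transpose j k) k = X i j * X j k"
proof -
  define q where "q = transpose i j \<circ> transpose j k"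
  have q: "q permutes {0..<n}" "q k = i" "q i = j"
    using assms by (auto simp: q_def intro!: permutes_compose permutes_swap_id)
  have "transpose i (q i) \<circ> q = transpose j k"
    unfolding q(3) by (simp add: q_def flip: comp_assoc)
  then show ?thesis
    using minor_weight_bypass[OF q(1) _ q(2), of X] minor_weight_transpose[of n X j k] q assms
    by (simp flip: q_def)
qed

text \<open>
  For distinct \<open>i\<close>, \<open>j\<close>, \<open>k\<close>, the transposition and the 3-cycle contribute both \<open>X i k\<close> and
  \<open>X i j * X j k\<close> to the entry \<open>(i, k)\<close> of the second adjoint, which is therefore ghost
  whenever the two have the same \<open>\<nu>\<close>-value.
\<close>

lemma cof_cof_triangle:
  fixes B :: "nat \<Rightarrow> nat \<Rightarrow> 'a::supertropical_semiring"
  assumes B: "definite n B" and ijk: "i < n" "j < n" "k < n" "i \<noteq> j" "j \<noteq> k"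
  shows "cof n (cof n B) i j * cof n (cof n B) j k \<sqsubset> cof n (cof n B) i k"
proof (cases "i = k")
  case True
  then show ?thesis
    using cof_cycle_absorbed[OF definite_cof[OF B], of i j] cof_diag[OF definite_cof[OF B], of i] ijk
    by simp
next
  case False
  define X where "X = cof n B"
  have X: "definite n X"
    unfolding X_def by (rule definite_cof[OF B])
  have triangle: "X i j * X j k \<lesssim> X i k" if "k < n" for i j k
    unfolding X_def using B that by (rule cof_triangle)
  let ?x = "cof n X i j * cof n X j k" and ?s = "X i j * X j k" and ?b = "X i k"
  let ?p = "transpose i k" and ?q = "transpose i j \<circ> transpose j k"
  let ?P = "{p. p permutes {0..<n} \<and> p k = i}"
  let ?r = "sum (\<lambda>p. minor_weight n X p k) (?P - {?p} - {?q})"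
  \<comment> \<open>The transposition fixes \<open>j\<close> and the 3-cycle moves it to
    \<open>k\<close>, so they contribute two separate terms to the sum.\<close>
  have "?p j \<noteq> ?q j"
    using ijk False by (auto simp: transpose_def)
  then have "?p \<noteq> ?q"
    by metis
  have p: "?p \<in> ?P"
    using ijk by (auto intro: permutes_swap_id)
  have q: "?q \<in> ?P - {?p}"
    using ijk \<open>?p \<noteq> ?q\<close> by (auto intro!: permutes_compose permutes_swap_id)
  have "cof n X i k = minor_weight n X ?p k + (minor_weight n X ?q k + ?r)"
    unfolding cof_def sum.remove[OF finite_permutations_fixing p]
    by (simp only: sum.remove[OF _ q] finite_permutations_fixing finite_Diff)
  also have "\<dots> = ?b + (?s + ?r)"
    using minor_weight_transpose[of n X i k] minor_weight_three_cycle[of n X i j k]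
      definite_diag[OF X] ijk False by simp
  finally have C: "cof n X i k = (?s + ?b) + ?r"
    by (simp add: ac_simps)
  \<comment> \<open>In the presence of \<open>?b\<close>, the sum \<open>?s\<close> counts as its
    ghost \<open>?s + ?s\<close>, which is what absorbs \<open>?x\<close>.\<close>
  have double: "?s + ?s + ?b = ?s + ?b"
    unfolding X_def using B ijk by (intro cof_mult_add_double)
  have "cof n X i j \<lesssim> X i j" "cof n X j k \<lesssim> X j k"
    using X triangle ijk by (auto intro: cof_nu_le)
  then have "?x \<sqsubset> ?s + ?s"
    using nu_le_mult unfolding nu_le_def by blast
  then have "?x \<sqsubset> ?s + ?b"
    using absorbed_add_right[of ?x "?s + ?s" ?b] double by simp
  then have "?x \<sqsubset> cof n X i k"
    unfolding C by (rule absorbed_add_right)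
  then show ?thesis
    by (simp only: X_def)
qed

section \<open>Reduction to definite matrices\<close>

lemma definite_permanent:
  assumes "definite n Y"
  shows "(\<Sum>p | p permutes {0..<n}. full_weight n Y p) = 1"
proof -
  have "(\<Sum>p | p permutes {0..<n}. full_weight n Y p) = full_weight n Y id"
    using full_weight_id[OF assms]
    by (intro sum_absorbed_eq_member)
       (auto simp: finite_permutations permutes_id intro: definite_absorbed[OF assms])
  then show ?thesis
    by (simp only: full_weight_id[OF assms])
qed

lemma permanent_eq_sum_full_weight:
  assumes "A \<in> carrier_mat n n"
  shows "permanent A = (\<Sum>p | p permutes {0..<n}. full_weight n (\<lambda>i j. A $$ (i, j)) p)"
  using assms by (simp add: permanent_def full_weight_def)

lemma permutation_insert_insert_index:
  "permutation_insert j i q (insert_index j k) = insert_index i (q k)"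
  by (simp add: permutation_insert_expand insert_index_def)

text \<open>The permutations sending \<open>j\<close> to \<open>i\<close> are the
  \<open>permutation_insert j i q\<close> with \<open>q\<close> permuting the indices of the minor;
  \<open>insert_index j\<close> renumbers the rows other than \<open>j\<close>.\<close>

lemma adjoint_index:
  assumes A: "A \<in> carrier_mat n n" and ij: "i < n" "j < n"
  shows "adjoint A $$ (i, j) = cof n (\<lambda>i j. A $$ (i, j)) i j"
proof -
  obtain m where n: "n = Suc m"
    using ij by (cases n) auto
  have "minor_weight n (\<lambda>i j. A $$ (i, j)) (permutation_insert j i q) j
      = (\<Prod>k = 0..<m. mat_delete A j i $$ (k, q k))" if q: "q permutes {0..<m}" for q
  proof -
    let ?p = "permutation_insert j i q"
    have "minor_weight n (\<lambda>i j. A $$ (i, j)) ?p j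
        = (\<Prod>k\<in>insert_index j ` {0..<m}. A $$ (k, ?p k))"
      using ij by (simp add: minor_weight_def n insert_index_image)
    also have "\<dots> = (\<Prod>k = 0..<m. A $$ (insert_index j k, insert_index i (q k)))"
      by (subst prod.reindex) (auto simp: insert_index_inj_on permutation_insert_insert_index)
    also have "\<dots> = (\<Prod>k = 0..<m. mat_delete A j i $$ (k, q k))"
      using A ij permutes_in_image[OF q] by (intro prod.cong refl mat_delete_index) (auto simp: n)
    finally show ?thesis .
  qed
  moreover have "cof n (\<lambda>i j. A $$ (i, j)) i j
      = (\<Sum>q | q permutes {0..<m}. minor_weight n (\<lambda>i j. A $$ (i, j)) (permutation_insert j i q) j)"
    unfolding cof_def n permutation_fix[OF ij(2,1)[unfolded n]]
    by (subst sum.reindex) (use ij permutation_insert_inj_on in \<open>auto simp: n\<close>)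
  moreover have "permanent (mat_delete A j i)
      = (\<Sum>q | q permutes {0..<m}. \<Prod>k = 0..<m. mat_delete A j i $$ (k, q k))"
    using A by (simp add: permanent_def n)
  ultimately show ?thesis
    using A ij by (simp add: adjoint_def)
qed

lemma nabla_carrier [simp]: "A \<in> carrier_mat n n \<Longrightarrow> nabla A \<in> carrier_mat n n"
  by (auto simp: nabla_def adjoint_def)

text \<open>\<open>X\<close> is \<open>Y\<close> with rows and columns scaled and relabelled. A
  permutation meets every row and every column once, so the scalars factor out completely.\<close>

lemma full_weight_monomial:
  assumes \<tau>: "\<tau> permutes {0..<n}" and q: "q permutes {0..<n}"
    and X: "\<And>k l. k < n \<Longrightarrow> l < n \<Longrightarrow> X (\<tau> k) (\<rho> l) = a k * b l * Y k l"
  shows "full_weight n X (\<rho> \<circ> q \<circ> Hilbert_Choice.inv \<tau>) = prod a {0..<n} * prod b {0..<n} * full_weight n Y q"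
proof -
  have "full_weight n X (\<rho> \<circ> q \<circ> Hilbert_Choice.inv \<tau>) = (\<Prod>k\<in>{0..<n}. X (\<tau> k) (\<rho> (q k)))"
    unfolding full_weight_def using prod.permute[OF \<tau>, of "\<lambda>m. X m ((\<rho> \<circ> q \<circ> Hilbert_Choice.inv \<tau>) m)"]
    by (simp add: permutes_inverses[OF \<tau>] o_def)
  also have "\<dots> = (\<Prod>k\<in>{0..<n}. a k * b (q k) * Y k (q k))"
    using permutes_in_image[OF q] by (intro prod.cong) (auto simp: X)
  also have "\<dots> = prod a {0..<n} * (\<Prod>k\<in>{0..<n}. b (q k)) * full_weight n Y q"
    by (simp add: prod.distrib full_weight_def)
  also have "(\<Prod>k\<in>{0..<n}. b (q k)) = prod b {0..<n}"
    using prod.permute[OF q, of b] by (simp add: o_def)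
  finally show ?thesis .
qed

text \<open>The prefactor supplies the scalars of the omitted row and of its column, which completes
  both products without any division.\<close>

lemma minor_weight_monomial:
  assumes \<tau>: "\<tau> permutes {0..<n}" and q: "q permutes {0..<n}" and k: "k < n"
    and X: "\<And>k l. k < n \<Longrightarrow> l < n \<Longrightarrow> X (\<tau> k) (\<rho> l) = a k * b l * Y k l"
  shows "a k * b (q k) * minor_weight n X (\<rho> \<circ> q \<circ> Hilbert_Choice.inv \<tau>) (\<tau> k)
       = prod a {0..<n} * prod b {0..<n} * minor_weight n Y q k"
proof -
  have \<tau>_inj: "inj_on \<tau> A" for A
    using permutes_inj[OF \<tau>] by (rule inj_on_subset) simp
  have "{0..<n} - {\<tau> k} = \<tau> ` ({0..<n} - {k})"
    using permutes_image[OF \<tau>] permutes_inj[OF \<tau>] by (simp add: image_set_diff)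
  then have "minor_weight n X (\<rho> \<circ> q \<circ> Hilbert_Choice.inv \<tau>) (\<tau> k) = (\<Prod>m\<in>{0..<n} - {k}. X (\<tau> m) (\<rho> (q m)))"
    unfolding minor_weight_def by (simp add: prod.reindex[OF \<tau>_inj] permutes_inverses[OF \<tau>])
  also have "\<dots> = (\<Prod>m\<in>{0..<n} - {k}. a m * b (q m) * Y m (q m))"
    using permutes_in_image[OF q] by (intro prod.cong) (auto simp: X)
  also have "\<dots> = (\<Prod>m\<in>{0..<n} - {k}. a m) * (\<Prod>m\<in>{0..<n} - {k}. b (q m)) * minor_weight n Y q k"
    by (simp add: prod.distrib minor_weight_def)
  finally have "a k * b (q k) * minor_weight n X (\<rho> \<circ> q \<circ> Hilbert_Choice.inv \<tau>) (\<tau> k)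
      = (a k * (\<Prod>m\<in>{0..<n} - {k}. a m)) * (b (q k) * (\<Prod>m\<in>{0..<n} - {k}. b (q m)))
        * minor_weight n Y q k"
    by (simp add: ac_simps)
  also have "a k * (\<Prod>m\<in>{0..<n} - {k}. a m) = prod a {0..<n}"
    using k by (simp add: prod.remove)
  also have "b (q k) * (\<Prod>m\<in>{0..<n} - {k}. b (q m)) = (\<Prod>m\<in>{0..<n}. b (q m))"
    using k by (simp add: prod.remove)
  also have "\<dots> = prod b {0..<n}"
    using prod.permute[OF q, of b] by (simp add: o_def)
  finally show ?thesis .
qed

lemma bij_betw_conjugate_permutations:
  assumes "\<tau> permutes S" "\<rho> permutes S"
  shows "bij_betw (\<lambda>q. \<rho> \<circ> q \<circ> Hilbert_Choice.inv \<tau>) {q. q permutes S} {p. p permutes S}"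
proof (rule bij_betw_byWitness[where f' = "\<lambda>p. Hilbert_Choice.inv \<rho> \<circ> p \<circ> \<tau>"])
  show "\<forall>q\<in>{q. q permutes S}. Hilbert_Choice.inv \<rho> \<circ> (\<rho> \<circ> q \<circ> Hilbert_Choice.inv \<tau>) \<circ> \<tau> = q"
    using permutes_inverses[OF assms(1)] permutes_inverses[OF assms(2)] by (simp add: fun_eq_iff)
  show "\<forall>p\<in>{p. p permutes S}. \<rho> \<circ> (Hilbert_Choice.inv \<rho> \<circ> p \<circ> \<tau>) \<circ> Hilbert_Choice.inv \<tau> = p"
    using permutes_inverses[OF assms(1)] permutes_inverses[OF assms(2)] by (simp add: fun_eq_iff)
qed (use assms in \<open>auto intro!: permutes_compose permutes_inv\<close>)

lemma sum_full_weight_monomial: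
  assumes \<tau>: "\<tau> permutes {0..<n}" and \<rho>: "\<rho> permutes {0..<n}"
    and X: "\<And>k l. k < n \<Longrightarrow> l < n \<Longrightarrow> X (\<tau> k) (\<rho> l) = a k * b l * Y k l"
  shows "(\<Sum>p | p permutes {0..<n}. full_weight n X p)
       = prod a {0..<n} * prod b {0..<n} * (\<Sum>p | p permutes {0..<n}. full_weight n Y p)"
proof -
  have "(\<Sum>p | p permutes {0..<n}. full_weight n X p)
      = (\<Sum>q | q permutes {0..<n}. full_weight n X (\<rho> \<circ> q \<circ> Hilbert_Choice.inv \<tau>))"
    by (rule sum.reindex_bij_betw[OF bij_betw_conjugate_permutations[OF \<tau> \<rho>], symmetric])
  also have "\<dots> = (\<Sum>q | q permutes {0..<n}. prod a {0..<n} * prod b {0..<n} * full_weight n Y q)"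
    by (intro sum.cong refl full_weight_monomial[OF \<tau>]) (auto simp: X)
  finally show ?thesis
    by (simp only: sum_distrib_left)
qed

lemma cof_monomial:
  assumes \<tau>: "\<tau> permutes {0..<n}" and \<rho>: "\<rho> permutes {0..<n}" and k: "k < n"
    and X: "\<And>k l. k < n \<Longrightarrow> l < n \<Longrightarrow> X (\<tau> k) (\<rho> l) = a k * b l * Y k l"
  shows "a k * b l * cof n X (\<rho> l) (\<tau> k) = prod a {0..<n} * prod b {0..<n} * cof n Y l k"
proof -
  let ?h = "\<lambda>q. \<rho> \<circ> q \<circ> Hilbert_Choice.inv \<tau>"
  have fix_iff: "?h q (\<tau> k) = \<rho> l \<longleftrightarrow> q k = l" for q
    using permutes_inverses[OF \<tau>] permutes_inj[OF \<rho>] by (simp add: inj_eq)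
  have "bij_betw ?h {q \<in> {q. q permutes {0..<n}}. q k = l} {p \<in> {p. p permutes {0..<n}}. p (\<tau> k) = \<rho> l}"
    using bij_betw_conjugate_permutations[OF \<tau> \<rho>] by (rule bij_betw_Collect) (use fix_iff in simp)
  then have bij: "bij_betw ?h {q. q permutes {0..<n} \<and> q k = l} {p. p permutes {0..<n} \<and> p (\<tau> k) = \<rho> l}"
    by simp
  have "a k * b l * cof n X (\<rho> l) (\<tau> k)
      = (\<Sum>q | q permutes {0..<n} \<and> q k = l. a k * b l * minor_weight n X (?h q) (\<tau> k))"
    unfolding cof_def sum_distrib_left by (rule sum.reindex_bij_betw[OF bij, symmetric])
  also have "\<dots> = (\<Sum>q | q permutes {0..<n} \<and> q k = l.
      prod a {0..<n} * prod b {0..<n} * minor_weight n Y q k)"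
    using minor_weight_monomial[where X = X and \<rho> = \<rho> and a = a and b = b and Y = Y, OF \<tau> _ k X]
    by (intro sum.cong) auto
  finally show ?thesis
    by (simp only: cof_def sum_distrib_left)
qed

lemma unit_inverse_unit: "x dvd 1 \<Longrightarrow> inverse x dvd 1" for x :: "'a::supertropical_semiring"
  by (metis dvd_triv_right unit_inverse)

text \<open>Since \<open>Y\<close> has permanent \<open>1\<close>, \<open>permanent A\<close> is the
  product of all scalars and cancels the one in \<open>cof_monomial\<close>. The adjoint transposes,
  so the roles of \<tau> and \<rho> are exchanged.\<close>

lemma nabla_monomial:
  fixes A :: "'a::supertropical_semiring mat"
  assumes A: "A \<in> carrier_mat n n" and \<tau>: "\<tau> permutes {0..<n}" and \<rho>: "\<rho> permutes {0..<n}"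
    and eq: "\<And>k l. k < n \<Longrightarrow> l < n \<Longrightarrow> A $$ (\<tau> k, \<rho> l) = a k * b l * Y k l"
    and units: "\<And>k. k < n \<Longrightarrow> a k dvd 1" "\<And>k. k < n \<Longrightarrow> b k dvd 1"
    and Y: "definite n Y" and kl: "k < n" "l < n"
  shows "nabla A $$ (\<rho> l, \<tau> k) = inverse (a k) * inverse (b l) * cof n Y l k"
proof -
  let ?A = "\<lambda>i j. A $$ (i, j)" and ?d = "prod a {0..<n} * prod b {0..<n}"
  have d: "permanent A = ?d"
    unfolding permanent_eq_sum_full_weight[OF A] definite_permanent[OF Y]
    using sum_full_weight_monomial[where X = ?A and a = a and b = b and Y = Y, OF \<tau> \<rho> eq]
      definite_permanent[OF Y] by simp
  have "prod a {0..<n} dvd 1" "prod b {0..<n} dvd 1"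
    using prod_dvd_prod[of "{0..<n}" a "\<lambda>_. 1"] prod_dvd_prod[of "{0..<n}" b "\<lambda>_. 1"] units by auto
  then have "?d dvd 1"
    using mult_dvd_mono by fastforce
  then have inv_d: "?d * inverse ?d = 1"
    by (rule unit_inverse)
  have in_range: "\<rho> l < n" "\<tau> k < n"
    using kl permutes_in_image[OF \<tau>, of k] permutes_in_image[OF \<rho>, of l] by auto
  have inv_ab: "a k * inverse (a k) = 1" "b l * inverse (b l) = 1"
    using units kl by (auto intro: unit_inverse)
  have "nabla A $$ (\<rho> l, \<tau> k) = inverse ?d * cof n ?A (\<rho> l) (\<tau> k)"
    using A in_range adjoint_index[OF A in_range] by (simp add: nabla_def d adjoint_def)
  \<comment> \<open>Factors equal to \<open>1\<close> are inserted to create the prefactor that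
    \<open>cof_monomial\<close> needs.\<close>
  also have "\<dots> = (a k * inverse (a k)) * (b l * inverse (b l)) * \<dots>"
    by (simp add: inv_ab)
  also have "\<dots> = inverse (a k) * inverse (b l) * inverse ?d * (a k * b l * cof n ?A (\<rho> l) (\<tau> k))"
    by (simp only: ac_simps)
  also have "a k * b l * cof n ?A (\<rho> l) (\<tau> k) = ?d * cof n Y l k"
    by (rule cof_monomial[where X = ?A, OF \<tau> \<rho> kl(1) eq])
  also have "inverse (a k) * inverse (b l) * inverse ?d * (?d * cof n Y l k)
      = inverse (a k) * inverse (b l) * (?d * inverse ?d) * cof n Y l k"
    by (simp only: ac_simps)
  finally show ?thesis
    by (simp only: inv_d mult_1_right)
qed

text \<open>Applied to the permanent, this yields a permutation of maximal weight.\<close>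

lemma unit_sum_eq_member:
  fixes f :: "'b \<Rightarrow> 'a::supertropical_semiring"
  assumes "sum f I dvd 1"
  shows "\<exists>i\<in>I. sum f I = f i"
  using assms
proof (induction I rule: infinite_finite_induct)
  case (insert i I)
  then show ?case
    using unit_add_cases[of "f i" "sum f I"] by auto
qed auto

text \<open>A dominant permutation \<sigma> is moved to the diagonal by relabelling rows, and each
  row is divided by its entry there.\<close>

lemma definite_normal_form:
  fixes A :: "nat \<Rightarrow> nat \<Rightarrow> 'a::supertropical_semiring"
  assumes unit: "(\<Sum>p | p permutes {0..<n}. full_weight n A p) dvd 1"
  shows "\<exists>\<tau> a B. \<tau> permutes {0..<n} \<and> (\<forall>k<n. a k dvd 1) \<and> definite n B \<and>
           (\<forall>k<n. \<forall>l<n. A (\<tau> k) l = a k * B k l)"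
proof -
  let ?P = "{p. p permutes {0..<n}}"
  let ?d = "sum (full_weight n A) ?P"
  obtain \<sigma> where \<sigma>: "\<sigma> permutes {0..<n}" "?d = full_weight n A \<sigma>"
    using unit_sum_eq_member[OF unit] by auto
  define a where "a k = A (Hilbert_Choice.inv \<sigma> k) k" for k
  define B where "B k l = inverse (a k) * A (Hilbert_Choice.inv \<sigma> k) l" for k l
  note inv = permutes_inverses[OF \<sigma>(1)]
  have d: "?d = prod a {0..<n}"
    unfolding \<sigma>(2) full_weight_def a_def
    using prod.permute[OF \<sigma>(1), of "\<lambda>k. A (Hilbert_Choice.inv \<sigma> k) k"] by (simp add: inv o_def)
  have units: "a k dvd 1" if "k < n" for k
    using dvd_trans[OF dvd_prodI[of "{0..<n}" k a]] unit d that by auto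
  then have inv_a: "a k * inverse (a k) = 1" if "k < n" for k
    using that by (intro unit_inverse)
  have A: "A (Hilbert_Choice.inv \<sigma> k) l = a k * B k l" if "k < n" for k l
    using inv_a[OF that] by (simp add: B_def flip: mult.assoc)
  have "full_weight n B p \<sqsubset> 1" if p: "p permutes {0..<n}" "p \<noteq> id" for p
  proof -
    have ps: "p \<circ> \<sigma> \<in> ?P - {\<sigma>}"
    proof -
      have "p \<circ> \<sigma> \<noteq> \<sigma>"
        using p(2) inv by (metis comp_apply eq_id_iff)
      then show ?thesis
        using p(1) \<sigma>(1) by (auto intro: permutes_compose)
    qed
    have fin: "finite ?P"
      by (simp add: finite_permutations)
    \<comment> \<open>The whole sum equals its term at \<sigma>, so that term absorbs the sum of all
      others, and by \<open>absorbed_addD\<close> each of them.\<close>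
    have "sum (full_weight n A) (?P - {\<sigma>}) \<sqsubset> ?d"
      using sum.remove[OF fin, of \<sigma> "full_weight n A"] \<sigma> by (simp add: absorbed_def add.commute)
    then have absorbed: "full_weight n A (p \<circ> \<sigma>) \<sqsubset> ?d"
      using sum.remove[OF _ ps, of "full_weight n A"] fin by (auto intro: absorbed_addD)
    have "full_weight n A (p \<circ> \<sigma>) = (\<Prod>k\<in>{0..<n}. A (Hilbert_Choice.inv \<sigma> k) (p k))"
      unfolding full_weight_def
      using prod.permute[OF \<sigma>(1), of "\<lambda>k. A (Hilbert_Choice.inv \<sigma> k) (p k)"] by (simp add: inv o_def)
    then have "full_weight n B p = (\<Prod>k\<in>{0..<n}. inverse (a k)) * full_weight n A (p \<circ> \<sigma>)"
      by (simp add: full_weight_def[of n B] B_def prod.distrib)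
    also have "\<dots> \<sqsubset> (\<Prod>k\<in>{0..<n}. inverse (a k)) * ?d"
      using absorbed by (rule absorbed_mult_left)
    also have "(\<Prod>k\<in>{0..<n}. inverse (a k)) * ?d = (\<Prod>k\<in>{0..<n}. a k * inverse (a k))"
      by (simp add: d prod.distrib mult.commute)
    also have "\<dots> = 1"
      using inv_a by (intro prod.neutral) auto
    finally show ?thesis .
  qed
  moreover have "B k k = 1" if "k < n" for k
    using inv_a[OF that] by (simp add: B_def a_def mult.commute)
  ultimately have "definite n B"
    by (auto simp: definite_def)
  then show ?thesis
    using permutes_inv[OF \<sigma>(1)] units A by blast
qed

section \<open>Factorization\<close>

lemma elementary_mat_carrier: "elementary_mat U n E \<Longrightarrow> E \<in> carrier_mat n n"
  by (induction rule: elementary_mat.induct) auto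

lemma factorizable_carrier: "factorizable U n A \<Longrightarrow> A \<in> carrier_mat n n"
proof -
  have "foldr (*) Es (1\<^sub>m n) \<in> carrier_mat n n" if "\<forall>E\<in>set Es. elementary_mat U n E" for Es
    using that by (induction Es) (auto intro: mult_carrier_mat elementary_mat_carrier)
  then show "factorizable U n A \<Longrightarrow> A \<in> carrier_mat n n"
    by (auto simp: factorizable_def)
qed

lemma factorizable_one: "factorizable U n (1\<^sub>m n)"
  unfolding factorizable_def by (intro exI[of _ "[]"]) auto

lemma factorizable_elementary_mult:
  assumes "elementary_mat U n E" "factorizable U n A"
  shows "factorizable U n (E * A)"
proof -
  obtain Es where "\<forall>E\<in>set Es. elementary_mat U n E" "A = foldr (*) Es (1\<^sub>m n)"
    using assms(2) by (auto simp: factorizable_def)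
  then show ?thesis
    unfolding factorizable_def using assms(1) by (intro exI[of _ "E # Es"]) auto
qed

lemma factorizable_mult:
  assumes "factorizable U n A" "factorizable U n B"
  shows "factorizable U n (A * B)"
proof -
  have B: "B \<in> carrier_mat n n"
    using assms(2) by (rule factorizable_carrier)
  have "factorizable U n (foldr (*) Es (1\<^sub>m n) * B)" if "\<forall>E\<in>set Es. elementary_mat U n E" for Es
    using that
  proof (induction Es)
    case Nil
    then show ?case
      using assms(2) B by simp
  next
    case (Cons E Es)
    let ?P = "foldr (*) Es (1\<^sub>m n)"
    have E: "E \<in> carrier_mat n n"
      using Cons.prems elementary_mat_carrier by auto
    have "factorizable U n ?P"
      using Cons.prems by (auto simp: factorizable_def)
    then have P: "?P \<in> carrier_mat n n"
      by (rule factorizable_carrier)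
    show ?case
      using factorizable_elementary_mult[of U n E "?P * B"] Cons assoc_mult_mat[OF E P B] by simp
  qed
  then show ?thesis
    using assms(1) by (auto simp: factorizable_def)
qed

lemma factorizable_swaprows:
  assumes "factorizable U n A" "i < n" "j < n"
  shows "factorizable U n (swaprows i j A)"
proof (cases "i = j")
  case True
  have "swaprows i i A = A"
    by (rule eq_matI) (auto split: if_splits)
  then show ?thesis
    using assms(1) True by simp
next
  case False
  have "swaprows i j A = swaprows_mat n i j * A"
    by (rule swaprows_mat[OF factorizable_carrier[OF assms(1)] assms(2,3)])
  then show ?thesis
    using assms False by (auto intro: factorizable_elementary_mult elementary_mat.switch)
qed

lemma factorizable_multrow:
  assumes "factorizable U n A" "i < n" "k \<in> U"
  shows "factorizable U n (multrow i k A)"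
  unfolding multrow_mat[OF factorizable_carrier[OF assms(1)]]
  using assms by (auto intro: factorizable_elementary_mult elementary_mat.scale)

lemma factorizable_addrow:
  fixes A :: "'a::supertropical_semiring mat"
  assumes A: "factorizable {x. x dvd 1} n A" and ij: "i < n" "j < n" "i \<noteq> j"
  shows "factorizable {x. x dvd 1} n (addrow c i j A)"
proof -
  have carrier: "A \<in> carrier_mat n n"
    using A by (rule factorizable_carrier)
  have unit: "factorizable {x. x dvd 1} n (addrow y i j X)"
    if "factorizable {x. x dvd 1} n X" "y dvd 1" for y and X :: "'a mat"
    unfolding addrow_mat[OF factorizable_carrier[OF that(1)] ij(2)]
    using that ij by (auto intro: factorizable_elementary_mult elementary_mat.add)
  \<comment> \<open>Elementary scalars must be invertible: zero takes no factor at all, and a ghost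
    \<open>y + y\<close> is reached by adding \<open>y\<close> twice.\<close>
  consider "c = 0" | "c dvd 1" | y where "y dvd 1" "c = y + y"
    using unit_or_ghost by blast
  then show ?thesis
  proof cases
    case 1
    then have "addrow c i j A = A"
      using carrier ij by (intro eq_matI) auto
    then show ?thesis
      using A by simp
  next
    case 2
    then show ?thesis
      using A unit by blast
  next
    case 3
    have "addrow c i j A = addrow y i j (addrow y i j A)"
      using carrier ij by (intro eq_matI) (auto simp: 3 distrib_right add.assoc)
    then show ?thesis
      using unit[OF unit[OF A 3(1)] 3(1)] by simp
  qed
qed

text \<open>
  The elementary factors may be multiplied in any order: each product of two or more of the
  off-diagonal parts is absorbed by the corresponding entry of \<open>C\<close>.
\<close>

lemma factorizable_of_absorbing:
  fixes C :: "nat \<Rightarrow> nat \<Rightarrow> 'a::supertropical_semiring"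
  assumes diag: "\<And>i. i < n \<Longrightarrow> C i i = 1"
    and absorbing: "\<And>i j k. i < n \<Longrightarrow> j < n \<Longrightarrow> k < n \<Longrightarrow> i \<noteq> j \<Longrightarrow> j \<noteq> k \<Longrightarrow> C i j * C j k \<sqsubset> C i k"
  shows "factorizable {x. x dvd 1} n (mat n n (\<lambda>(i, j). C i j))"
proof -
  let ?T = "{(i, j). i < n \<and> j < n \<and> i \<noteq> j}"
  define P where "P ts = foldr (\<lambda>(i, j). addrow (C i j) i j) ts (1\<^sub>m n)" for ts
  have P_Nil: "P [] = 1\<^sub>m n" and P_Cons: "P ((k, l) # ts) = addrow (C k l) k l (P ts)" for k l ts
    by (simp_all add: P_def)
  have fact: "factorizable {x. x dvd 1} n (P ts)" if "set ts \<subseteq> ?T" for ts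
    using that
    by (induction ts) (auto simp: P_Nil P_Cons intro: factorizable_one factorizable_addrow)
  \<comment> \<open>\<open>X\<close> collects the products of several off-diagonal parts.
    Distinctness keeps \<open>C i j\<close> from being added twice, which would turn a tangible
    entry into a ghost.\<close>
  have entries: "\<exists>X. \<forall>i<n. \<forall>j<n. X i j \<sqsubset> C i j \<and>
      P ts $$ (i, j) = (if i = j \<or> (i, j) \<in> set ts then C i j else 0) + X i j"
    if "set ts \<subseteq> ?T" "distinct ts" for ts
    using that
  proof (induction ts)
    case Nil
    then show ?case
      by (intro exI[of _ "\<lambda>_ _. 0"]) (auto simp: P_Nil diag)
  next
    case (Cons t ts)
    obtain k l where t: "t = (k, l)" "k < n" "l < n" "k \<noteq> l" "(k, l) \<notin> set ts"
      using Cons.prems by auto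
    obtain X where X: "\<And>i j. i < n \<Longrightarrow> j < n \<Longrightarrow> X i j \<sqsubset> C i j"
        "\<And>i j. i < n \<Longrightarrow> j < n \<Longrightarrow>
          P ts $$ (i, j) = (if i = j \<or> (i, j) \<in> set ts then C i j else 0) + X i j"
      using Cons by auto
    have carrier: "P ts \<in> carrier_mat n n"
      using Cons.prems by (auto intro!: factorizable_carrier fact)
    \<comment> \<open>Row \<open>l\<close>, multiplied by \<open>C k l\<close>, is added to row
      \<open>k\<close>. Its diagonal \<open>1\<close> yields the new entry \<open>C k l\<close>; its
      entries \<open>C l j\<close> and its remainder \<open>X l j\<close> yield terms absorbed by
      \<open>C k j\<close>.\<close>
    define Y where "Y i j = (if i = k then
        (if l \<noteq> j \<and> (l, j) \<in> set ts then C k l * C l j else 0) + C k l * X l j else 0) + X i j" for i j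
    have "C k l * X l j \<sqsubset> C k j" if "j < n" for j
    proof (cases "l = j")
      case True
      then show ?thesis
        using absorbed_mult_left[OF X(1), of l j "C k l"] t diag by simp
    next
      case False
      then show ?thesis
        using absorbed_mult_left[OF X(1), of l j "C k l"] absorbing[of k l j] t that
        by (auto intro: absorbed_trans)
    qed
    then have "Y i j \<sqsubset> C i j" if "i < n" "j < n" for i j
      unfolding Y_def using that t X(1) absorbing[of k l j] by (auto intro!: absorbed_add_left)
    moreover have "P (t # ts) $$ (i, j) = (if i = j \<or> (i, j) \<in> set (t # ts) then C i j else 0) + Y i j"
      if "i < n" "j < n" for i j
      using that t carrier X(2)[of i j] X(2)[of l j]
      by (auto simp: P_Cons Y_def diag distrib_left ac_simps)
    ultimately show ?case
      by blast
  qed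
  have "finite ?T"
    by (rule finite_subset[of _ "{0..<n} \<times> {0..<n}"]) auto
  then obtain ts where ts: "set ts = ?T" "distinct ts"
    using finite_distinct_list by blast
  obtain X where X: "\<And>i j. i < n \<Longrightarrow> j < n \<Longrightarrow> X i j \<sqsubset> C i j"
      "\<And>i j. i < n \<Longrightarrow> j < n \<Longrightarrow> P ts $$ (i, j) = (if i = j \<or> (i, j) \<in> set ts then C i j else 0) + X i j"
    using entries[of ts] ts by auto
  have "P ts $$ (i, j) = C i j" if "i < n" "j < n" for i j
    using X[OF that] that ts by (auto simp: absorbed_def add.commute)
  then have "P ts = mat n n (\<lambda>(i, j). C i j)"
    using factorizable_carrier[OF fact[of ts]] ts by (intro eq_matI) auto
  then show ?thesis
    using fact[of ts] ts by simp
qed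

lemma factorizable_permute_rows:
  assumes "\<tau> permutes {0..<n}" "factorizable U n A"
  shows "factorizable U n (mat n n (\<lambda>(i, j). A $$ (\<tau> i, j)))"
  using assms(1) finite_atLeastLessThan assms(2)
proof (induction arbitrary: A rule: permutes_induct)
  case id
  then have "mat n n (\<lambda>(i, j). A $$ (id i, j)) = A"
    using factorizable_carrier[OF id] by (intro eq_matI) auto
  then show ?case
    using id by simp
next
  case (swap a b p)
  have "mat n n (\<lambda>(i, j). A $$ ((transpose a b \<circ> p) i, j))
      = mat n n (\<lambda>(i, j). swaprows a b A $$ (p i, j))"
    using factorizable_carrier[OF swap.prems] permutes_in_image[OF swap.hyps(4)]
    by (intro eq_matI) (auto simp: transpose_def)
  then show ?case
    using swap by (simp add: factorizable_swaprows)
qed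

lemma factorizable_scale_rows:
  assumes "\<And>i. i < n \<Longrightarrow> u i \<in> U" "factorizable U n A"
  shows "factorizable U n (mat n n (\<lambda>(i, j). u i * A $$ (i, j)))"
proof -
  let ?S = "\<lambda>m. mat n n (\<lambda>(i, j). if i < m then u i * A $$ (i, j) else A $$ (i, j))"
  have "factorizable U n (?S m)" if "m \<le> n" for m
    using that
  proof (induction m)
    case 0
    have "?S 0 = A"
      using factorizable_carrier[OF assms(2)] by (intro eq_matI) auto
    then show ?case
      using assms(2) by simp
  next
    case (Suc m)
    have "?S (Suc m) = multrow m (u m) (?S m)"
      by (intro eq_matI) (auto simp: less_Suc_eq)
    then show ?case
      using factorizable_multrow[of U n "?S m" m "u m"] Suc assms(1) by simp
  qed
  then have "factorizable U n (?S n)"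
    by simp
  moreover have "?S n = mat n n (\<lambda>(i, j). u i * A $$ (i, j))"
    by (intro eq_matI) auto
  ultimately show ?thesis
    by simp
qed

lemma factorizable_monomial_rows:
  assumes \<tau>: "\<tau> permutes {0..<n}" and u: "\<And>k. k < n \<Longrightarrow> u k \<in> U"
    and C: "factorizable U n (mat n n (\<lambda>(k, l). C k l))" and X: "X \<in> carrier_mat n n"
    and eq: "\<And>k l. k < n \<Longrightarrow> l < n \<Longrightarrow> X $$ (\<tau> k, l) = u k * C k l"
  shows "factorizable U n X"
proof -
  let ?\<sigma> = "Hilbert_Choice.inv \<tau>"
  let ?D = "mat n n (\<lambda>(k, l). u k * mat n n (\<lambda>(k, l). C k l) $$ (k, l))"
  have \<sigma>: "?\<sigma> permutes {0..<n}" "\<tau> (?\<sigma> i) = i" for i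
    using permutes_inv[OF \<tau>] permutes_inverses[OF \<tau>] by auto
  have range: "?\<sigma> i < n" if "i < n" for i
    using permutes_in_image[OF \<sigma>(1), of i] that by simp
  have "factorizable U n (mat n n (\<lambda>(i, j). ?D $$ (?\<sigma> i, j)))"
    using \<sigma>(1) u C by (intro factorizable_permute_rows factorizable_scale_rows)
  moreover have "mat n n (\<lambda>(i, j). ?D $$ (?\<sigma> i, j)) = X"
  proof (intro eq_matI)
    fix i j assume "i < dim_row X" "j < dim_col X"
    then have ij: "i < n" "j < n"
      using X by auto
    then show "mat n n (\<lambda>(i, j). ?D $$ (?\<sigma> i, j)) $$ (i, j) = X $$ (i, j)"
      using eq[OF range[OF ij(1)] ij(2)] range \<sigma>(2) by simp
  qed (use X in auto)
  ultimately show ?thesis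
    by simp
qed

text \<open>Column operations are multiplications from the right by a monomial matrix, which is
  itself obtained from the identity by row operations.\<close>

lemma factorizable_monomial_cols:
  assumes \<tau>: "\<tau> permutes {0..<n}" and u: "\<And>k. k < n \<Longrightarrow> u k \<in> U"
    and C: "factorizable U n (mat n n (\<lambda>(k, l). C k l))" and X: "X \<in> carrier_mat n n"
    and eq: "\<And>k l. k < n \<Longrightarrow> l < n \<Longrightarrow> X $$ (l, \<tau> k) = C l k * u k"
  shows "factorizable U n X"
proof -
  let ?C = "mat n n (\<lambda>(k, l). C k l)"
  let ?D = "mat n n (\<lambda>(k, j). u k * mat n n (\<lambda>(k, j). 1\<^sub>m n $$ (\<tau> k, j)) $$ (k, j))"
  have "factorizable U n (?C * ?D)"
    using \<tau> u by (intro factorizable_mult[OF C] factorizable_scale_rows factorizable_permute_rows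
        factorizable_one)
  moreover have "?C * ?D = X"
  proof (intro eq_matI)
    fix l j assume "l < dim_row X" "j < dim_col X"
    then have lj: "l < n" "j < n"
      using X by auto
    obtain k where k: "k < n" "\<tau> k = j"
      using lj permutes_image[OF \<tau>] by (metis atLeastLessThan_iff imageE zero_le)
    have "(?C * ?D) $$ (l, j) = (\<Sum>m\<in>{0..<n}. C l m * (u m * 1\<^sub>m n $$ (\<tau> m, j)))"
      using lj by (simp add: scalar_prod_def)
    also have "\<dots> = (\<Sum>m\<in>{0..<n}. if m = k then C l k * u k else 0)"
    proof (intro sum.cong refl)
      fix m assume "m \<in> {0..<n}"
      then have "\<tau> m < n" "\<tau> m = j \<longleftrightarrow> m = k"
        using permutes_in_image[OF \<tau>, of m] permutes_inj[OF \<tau>] k(2) by (auto dest: injD)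
      then show "C l m * (u m * 1\<^sub>m n $$ (\<tau> m, j)) = (if m = k then C l k * u k else 0)"
        using lj by simp
    qed
    also have "\<dots> = X $$ (l, j)"
      using eq[OF k(1) lj(1)] k by simp
    finally show "(?C * ?D) $$ (l, j) = X $$ (l, j)" .
  qed (use X in auto)
  ultimately show ?thesis
    by simp
qed

section \<open>Factorizing \<open>nabla A\<close> and \<open>nabla (nabla A)\<close>\<close>

text \<open>The monomial factor acts on the rows of \<open>A\<close>; since the adjoint transposes,
  its inverse acts on the columns of \<open>nabla A\<close>.\<close>

lemma nabla_normal_form:
  fixes A :: "'a::supertropical_semiring mat"
  assumes A: "A \<in> carrier_mat n n" and unit: "permanent A dvd 1"
  shows "\<exists>\<tau> u B. \<tau> permutes {0..<n} \<and> (\<forall>k<n. u k dvd 1) \<and> definite n B \<and>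
           (\<forall>k<n. \<forall>l<n. nabla A $$ (l, \<tau> k) = cof n B l k * u k)"
proof -
  obtain \<tau> a B where \<tau>: "\<tau> permutes {0..<n}" and a: "\<forall>k<n. a k dvd 1" and B: "definite n B"
      and eq: "\<forall>k<n. \<forall>l<n. A $$ (\<tau> k, l) = a k * B k l"
    using definite_normal_form[of n "\<lambda>i j. A $$ (i, j)"] unit
    by (auto simp: permanent_eq_sum_full_weight[OF A])
  have "nabla A $$ (l, \<tau> k) = cof n B l k * inverse (a k)" if "k < n" "l < n" for k l
  proof -
    have "nabla A $$ (id l, \<tau> k) = inverse (a k) * inverse 1 * cof n B l k"
      using eq a B that
      by (intro nabla_monomial[where b = "\<lambda>_. 1"] A permutes_id \<tau>) auto
    then show ?thesis
      using unit_inverse[of "1 :: 'a"] by (simp add: mult.commute)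
  qed
  then show ?thesis
    using \<tau> a B by (intro exI[of _ \<tau>] exI[of _ "\<lambda>k. inverse (a k)"] exI[of _ B]) (auto intro: unit_inverse_unit)
qed

text \<open>As \<open>cof n B\<close> is definite, \<open>nabla_monomial\<close> applies again to
  \<open>nabla A\<close>. The monomial factor returns to the rows, and
  \<open>cof_cof_triangle\<close> makes the rest factorizable.\<close>

lemma factorizable_nabla_nabla:
  fixes A :: "'a::supertropical_semiring mat"
  assumes A: "A \<in> carrier_mat n n" and unit: "permanent A dvd 1"
  shows "factorizable {x. x dvd 1} n (nabla (nabla A))"
proof -
  obtain \<tau> u B where \<tau>: "\<tau> permutes {0..<n}" and u: "\<forall>k<n. u k dvd 1" and B: "definite n B"
      and eq: "\<forall>k<n. \<forall>l<n. nabla A $$ (l, \<tau> k) = cof n B l k * u k"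
    using nabla_normal_form[OF assms] by auto
  let ?C = "cof n (cof n B)"
  have "nabla (nabla A) $$ (\<tau> k, l) = inverse (u k) * ?C k l" if "k < n" "l < n" for k l
  proof -
    have "nabla (nabla A) $$ (\<tau> k, id l) = inverse 1 * inverse (u k) * ?C k l"
      using eq u definite_cof[OF B] that
      by (intro nabla_monomial[where a = "\<lambda>_. 1"] nabla_carrier A permutes_id \<tau>)
         (auto simp: mult.commute)
    then show ?thesis
      using unit_inverse[of "1 :: 'a"] by simp
  qed
  moreover have "factorizable {x. x dvd 1} n (mat n n (\<lambda>(k, l). ?C k l))"
    using B by (intro factorizable_of_absorbing cof_cof_triangle cof_diag definite_cof)
  ultimately show ?thesis
    using \<tau> u A unit_inverse_unit
    by (auto intro!: factorizable_monomial_rows[where u = "\<lambda>k. inverse (u k)" and C = ?C, OF \<tau>])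
qed

text \<open>With idempotent addition \<lesssim> coincides with \<sqsubset>, so
  \<open>cof_triangle\<close> already gives the absorption that the factorization requires.\<close>

lemma factorizable_nabla_idempotent:
  fixes A :: "'a::supertropical_semiring mat"
  assumes idem: "\<And>x :: 'a. x + x = x"
    and A: "A \<in> carrier_mat n n" and unit: "permanent A dvd 1"
  shows "factorizable {x. x dvd 1} n (nabla A)"
proof -
  obtain \<tau> u B where \<tau>: "\<tau> permutes {0..<n}" and u: "\<forall>k<n. u k dvd 1" and B: "definite n B"
      and eq: "\<forall>k<n. \<forall>l<n. nabla A $$ (l, \<tau> k) = cof n B l k * u k"
    using nabla_normal_form[OF A unit] by auto
  have "cof n B i j * cof n B j k \<sqsubset> cof n B i k" if "k < n" for i j k
    using cof_triangle[OF B that, of i j] by (simp add: nu_le_def idem)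
  then have "factorizable {x. x dvd 1} n (mat n n (\<lambda>(k, l). cof n B k l))"
    using B by (intro factorizable_of_absorbing cof_diag)
  then show ?thesis
    using \<tau> u A eq by (auto intro!: factorizable_monomial_cols[where u = u and C = "cof n B", OF \<tau>])
qed

theorem corollary6p6:
  fixes n :: nat
  assumes "n \<ge> 1"
  shows "(\<forall>A :: 'g::linordered_ab_group_add trop mat.
            A \<in> carrier_mat n n \<longrightarrow> permanent A \<noteq> 0 \<longrightarrow>
            factorizable (range TFin) n (nabla A)) \<and>
         (\<forall>A :: 'g supertrop mat.
            A \<in> carrier_mat n n \<longrightarrow> permanent A \<in> range STan \<longrightarrow>
            factorizable (range STan) n (nabla (nabla A)))"
proof -
  have units: "range TFin = {x :: 'g trop. x dvd 1}" "range STan = {x :: 'g supertrop. x dvd 1}"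
    by (simp_all only: trop_invertible_iff supertrop_invertible_iff Collect_mem_eq)
  have idem: "x + x = x" for x :: "'g trop"
    by (cases x) auto
  have "x dvd 1" if "x \<noteq> 0" for x :: "'g trop"
    using that unfolding trop_invertible_iff by (cases x) (auto simp: zero_trop_def)
  then show ?thesis
    unfolding units using factorizable_nabla_idempotent[OF idem] factorizable_nabla_nabla by blast
qed

end
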